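(* Let $\vartheta$ be an expanding primitive random substitution on a finite alphabet $\mathcal A$. Let $\mu_\vartheta:\mathfrak Z_0(\mathbb X_\vartheta)\to[0,1]$ be defined via $\mu_\vartheta(\varnothing)=0$, $\mu_\vartheta(\mathbb X_\vartheta)=1$ and $\mu_\vartheta(\mathcal Z_{[k,m]}(v))=R_v^{(\ell)}$ for any $k\le 0\le m$ in $\mathbb Z$ and $v\in\mathcal L_\vartheta^\ell$ with $\ell=|v|=m-k+1$, where $R^{(\ell)}$ is the normalised right Perron–Frobenius eigenvector of the induced substitution matrix $M_{\vartheta_\ell}$. Then $\mu_\vartheta$ defines a $\sigma$-finite measure on the semi-algebra $\mathfrak Z_0(\mathbb X_\vartheta)$ and thereby (by unique extension) also a measure on $(\mathbb X_\vartheta,\mathcal B_\vartheta)$.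
   Context: Words. $\mathcal A$ is a finite alphabet, $\mathcal A^+=\bigcup_{n\ge 1}\mathcal A^n$ is the set of non-empty finite words, $|u|$ is the length of $u$, $u_{[k,m]}=u_k\cdots u_m$, and $|u|_v$ is the number of (possibly overlapping) occurrences of $v$ as a subword of $u$; $v\triangleleft u$ means $|u|_v\ge 1$. Random substitution. A random substitution $\vartheta$ on $\mathcal A$ is determined by a map $a\mapsto P^\vartheta_a$ assigning to each $a\in\mathcal A$ a finitely supported probability measure on $\mathcal A^+$. The transition kernel is $P(u_1\cdots u_m,v)=\sum_{v^1\cdots v^m=v}P^\vartheta_{u_1}(v^1)\cdots P^\vartheta_{u_m}(v^m)$ (sum over $v^1,\dots,v^m\in\mathcal A^+$ with concatenation $v$). For $u=u_1\cdots u_m\in\mathcal A^+$, $(\vartheta^n(u))_{n\ge 0}$ is the Markov chain on $\mathcal A^+$ with $\vartheta^0(u)=u$ and transition kernel $P$; it is realised on one probability space so that $\vartheta^n(u)=\vartheta^n(u_1)\cdots\vartheta^n(u_m)$ pointwise for all $n$, where $(\vartheta^n(u_1))_n,\dots,(\vartheta^n(u_m))_n$ are independent Markov chains with kernel $P$ started at the letters $u_1,\dots,u_m$. The mean substitution matrix is $(M_\vartheta)_{ab}=\mathbb E|\vartheta(b)|_a$, $a,b\in\mathcal A$. $\vartheta$ is primitive if $M_\vartheta$ is a primitive matrix; a primitive $\vartheta$ is expanding if $\mathbb P[|\vartheta(a)|>1]>0$ for some $a\in\mathcal A$. Language and subshift. $\mathcal L_\vartheta=\{u\in\mathcal A^+: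 u\triangleleft v \text{ for some } v \text{ with } \mathbb P[\vartheta^n(a)=v]>0 \text{ for some } n\in\mathbb N, a\in\mathcal A\}$, $\mathcal L_\vartheta^\ell$ is the set of elements of $\mathcal L_\vartheta$ of length $\ell$, and $\mathbb X_\vartheta=\{x\in\mathcal A^{\mathbb Z}: x_{[k,m]}\in\mathcal L_\vartheta\text{ for all }k\le m\}$. Induced matrix. For $\ell\in\mathbb N$ let $\mathcal A_\ell=\mathcal L_\vartheta^\ell$. For $u=u_1\cdots u_\ell\in\mathcal A_\ell$ define the random word over the alphabet $\mathcal A_\ell$, $\vartheta_\ell(u)=(\vartheta(u)_{[k,k+\ell-1]})_{1\le k\le|\vartheta(u_1)|}$, and let $(M_{\vartheta_\ell})_{uv}=\mathbb E|\vartheta_\ell(v)|_u$ for $u,v\in\mathcal A_\ell$. It is known that for expanding primitive $\vartheta$ the matrix $M_{\vartheta_\ell}$ is primitive with the same Perron–Frobenius eigenvalue $\lambda$ as $M_\vartheta$. $R^{(\ell)}$ denotes its right Perron–Frobenius eigenvector with $\|R^{(\ell)}\|_1=1$. Cylinders. $\mathcal Z_{[k,m]}(v)=\{x\in\mathbb X_\vartheta:x_{[k,m]}=v\}$ for $k\le m$ in $\mathbb Z$, $v\in\mathcal L_\vartheta^{m-k+1}$; $\mathcal B_\vartheta$ is the Borel $\sigma$-algebra of the topology generated by the cylinder sets. $\mathfrak Z_0(\mathbb X_\vartheta)=\{\mathcal Z_{[k,m]}(v):k\le 0\le m,\ v\in\mathcal L_\vartheta^{m-k+1}\}\cup\{\mathbb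 X_\vartheta,\varnothing\}$, a semi-algebra generating $\mathcal B_\vartheta$ (contains the whole space, closed under intersections, complements are finite disjoint unions of members). A measure on a semi-algebra $\mathfrak S$ is a map $\mu:\mathfrak S\to[0,\infty]$ with $\mu(\varnothing)=0$ and $\mu(\bigcup_i A_i)=\sum_i\mu(A_i)$ whenever $A_1,A_2,\ldots\in\mathfrak S$ are pairwise disjoint with union in $\mathfrak S$. *)

theory Defs
  imports "HOL-Probability.Probability"
begin

section \<open>Words and random substitutions\<close>

text \<open>Words are lists. The number of (possibly overlapping) occurrences of \<open>v\<close> in \<open>u\<close>:\<close>

definition occ :: "'b list \<Rightarrow> 'b list \<Rightarrow> nat" where
  "occ v u = card {i. i + length v \<le> length u \<and> take (length v) (drop i u) = v}"

locale random_substitution =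
  fixes P :: "'a::finite \<Rightarrow> 'a list pmf"
  assumes finite_support: "finite (set_pmf (P a))"
    and nonempty_image: "[] \<notin> set_pmf (P a)"

text \<open>
  Joint law of the independent images of the letters of a word. It is kept separate from the law
  of their concatenation because the induced substitution also needs the length of the image of
  the first letter.
\<close>

primrec subst_blocks :: "('a \<Rightarrow> 'a list pmf) \<Rightarrow> 'a list \<Rightarrow> 'a list list pmf" where
  "subst_blocks P [] = return_pmf []"
| "subst_blocks P (a # u) = map_pmf (\<lambda>(w, ws). w # ws) (pair_pmf (P a) (subst_blocks P u))"

definition subst_word :: "('a \<Rightarrow> 'a list pmf) \<Rightarrow> 'a list \<Rightarrow> 'a list pmf" where
  "subst_word P u = map_pmf concat (subst_blocks P u)"

text \<open>Law at time \<open>n\<close> of the Markov chain with kernel \<open>subst_word P\<close> started at \<open>u\<close>:\<close>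

primrec subst_iter :: "('a \<Rightarrow> 'a list pmf) \<Rightarrow> nat \<Rightarrow> 'a list \<Rightarrow> 'a list pmf" where
  "subst_iter P 0 u = return_pmf u"
| "subst_iter P (Suc n) u = bind_pmf (subst_iter P n u) (subst_word P)"

lemma pmf_subst_blocks:
  "pmf (subst_blocks P u) ws =
    (if length ws = length u then \<Prod>i<length u. pmf (P (u ! i)) (ws ! i) else 0)"
proof (induction u arbitrary: ws)
  case Nil
  then show ?case by (auto simp: pmf_eq_0_set_pmf)
next
  case (Cons a u)
  show ?case
  proof (cases ws)
    case Nil
    then show ?thesis by (auto simp: pmf_eq_0_set_pmf)
  next
    case (Cons w ws')
    have inj: "inj (\<lambda>(w :: 'a list, ws). w # ws)" by (auto simp: inj_def)
    have "pmf (subst_blocks P (a # u)) ws = pmf (P a) w * pmf (subst_blocks P u) ws'"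
      using pmf_map_inj'[OF inj, of "pair_pmf (P a) (subst_blocks P u)" "(w, ws')"]
      by (simp add: Cons pmf_pair)
    then show ?thesis
      by (simp add: Cons Cons.IH lessThan_Suc_eq_insert_0 prod.reindex)
  qed
qed

text \<open>The transition kernel as the sum over factorisations into non-empty words:\<close>

lemma (in random_substitution) pmf_subst_word:
  "pmf (subst_word P u) v =
    (\<Sum>ws | length ws = length u \<and> concat ws = v \<and> [] \<notin> set ws. \<Prod>i<length u. pmf (P (u ! i)) (ws ! i))"
proof -
  define S where "S = {ws. length ws = length u \<and> concat ws = v \<and> [] \<notin> set ws}"
  have "S \<subseteq> {ws. set ws \<subseteq> {w. set w \<subseteq> UNIV \<and> length w \<le> length v} \<and> length ws = length u}"
    by (auto simp: S_def length_concat intro!: member_le_sum_list)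
  then have fin: "finite S"
    by (rule finite_subset) (intro finite_lists_length_eq finite_lists_length_le finite)
  have supp: "length ws = length u \<and> [] \<notin> set ws" if "ws \<in> set_pmf (subst_blocks P u)" for ws
    using that by (induction u arbitrary: ws) (auto, metis nonempty_image)
  have "pmf (subst_word P u) v = measure_pmf.prob (subst_blocks P u) (concat -` {v})"
    by (simp add: subst_word_def pmf_map)
  also have "\<dots> = measure_pmf.prob (subst_blocks P u) S"
    by (rule measure_prob_cong_0) (auto simp: S_def pmf_eq_0_set_pmf dest: supp)
  also have "\<dots> = (\<Sum>ws\<in>S. pmf (subst_blocks P u) ws)"
    using fin by (rule measure_measure_pmf_finite)
  also have "\<dots> = (\<Sum>ws\<in>S. \<Prod>i<length u. pmf (P (u ! i)) (ws ! i))"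
    by (intro sum.cong) (auto simp: S_def pmf_subst_blocks)
  finally show ?thesis by (simp add: S_def)
qed


section \<open>Non-negative matrices over a finite index set\<close>

text \<open>
  A square matrix indexed by a finite set \<open>I\<close> is a function \<open>'i \<Rightarrow> 'i \<Rightarrow> real\<close>, of which only the
  entries in \<open>I \<times> I\<close> matter. Index types are not enough since the words of length \<open>l\<close> in
  the language form an index set depending on \<open>l\<close>.
\<close>

primrec mat_power :: "'i set \<Rightarrow> ('i \<Rightarrow> 'i \<Rightarrow> real) \<Rightarrow> nat \<Rightarrow> 'i \<Rightarrow> 'i \<Rightarrow> real" where
  "mat_power I M 0 = (\<lambda>i j. if i = j then 1 else 0)"
| "mat_power I M (Suc n) = (\<lambda>i j. \<Sum>k\<in>I. M i k * mat_power I M n k j)"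

definition primitive_matrix :: "'i set \<Rightarrow> ('i \<Rightarrow> 'i \<Rightarrow> real) \<Rightarrow> bool" where
  "primitive_matrix I M \<longleftrightarrow>
    (\<forall>i\<in>I. \<forall>j\<in>I. 0 \<le> M i j) \<and> (\<exists>n>0. \<forall>i\<in>I. \<forall>j\<in>I. 0 < mat_power I M n i j)"

definition eigenvalues :: "'i set \<Rightarrow> ('i \<Rightarrow> 'i \<Rightarrow> real) \<Rightarrow> complex set" where
  "eigenvalues I M = {z. \<exists>x :: 'i \<Rightarrow> complex. (\<exists>i\<in>I. x i \<noteq> 0) \<and>
     (\<forall>i\<in>I. (\<Sum>j\<in>I. of_real (M i j) * x j) = z * x i)}"

text \<open>The Perron--Frobenius eigenvalue is the spectral radius.\<close>

definition PF_eigenvalue :: "'i set \<Rightarrow> ('i \<Rightarrow> 'i \<Rightarrow> real) \<Rightarrow> real" where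
  "PF_eigenvalue I M = Sup (cmod ` eigenvalues I M)"

text \<open>
  The entries outside \<open>I\<close> are set to zero so that the description is definite whenever the
  eigenvector is unique on \<open>I\<close>.
\<close>

definition PF_right_eigenvector :: "'i set \<Rightarrow> ('i \<Rightarrow> 'i \<Rightarrow> real) \<Rightarrow> 'i \<Rightarrow> real" where
  "PF_right_eigenvector I M = (THE R.
     (\<forall>i\<in>I. 0 < R i) \<and> (\<forall>i. i \<notin> I \<longrightarrow> R i = 0) \<and>
     (\<forall>i\<in>I. (\<Sum>j\<in>I. M i j * R j) = PF_eigenvalue I M * R i) \<and>
     (\<Sum>i\<in>I. \<bar>R i\<bar>) = 1)"


section \<open>Primitivity, language and subshift\<close>

definition subst_matrix :: "('a \<Rightarrow> 'a list pmf) \<Rightarrow> 'a \<Rightarrow> 'a \<Rightarrow> real" where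
  "subst_matrix P a b = measure_pmf.expectation (subst_word P [b]) (\<lambda>w. real (occ [a] w))"

definition primitive_subst :: "('a \<Rightarrow> 'a list pmf) \<Rightarrow> bool" where
  "primitive_subst P \<longleftrightarrow> primitive_matrix UNIV (subst_matrix P)"

definition expanding_subst :: "('a \<Rightarrow> 'a list pmf) \<Rightarrow> bool" where
  "expanding_subst P \<longleftrightarrow> (\<exists>a. measure_pmf.prob (subst_word P [a]) {w. length w > 1} > 0)"

definition language :: "('a \<Rightarrow> 'a list pmf) \<Rightarrow> 'a list set" where
  "language P = {u. u \<noteq> [] \<and> (\<exists>v n a. pmf (subst_iter P n [a]) v > 0 \<and> occ u v \<ge> 1)}"

definition language_len :: "('a \<Rightarrow> 'a list pmf) \<Rightarrow> nat \<Rightarrow> 'a list set" where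
  "language_len P l = {u \<in> language P. length u = l}"

definition window :: "(int \<Rightarrow> 'a) \<Rightarrow> int \<Rightarrow> int \<Rightarrow> 'a list" where
  "window x k m = map x [k..m]"

definition subshift :: "('a \<Rightarrow> 'a list pmf) \<Rightarrow> (int \<Rightarrow> 'a) set" where
  "subshift P = {x. \<forall>k m. k \<le> m \<longrightarrow> window x k m \<in> language P}"


section \<open>Induced substitution\<close>

text \<open>
  The argument \<open>ws\<close> is the list of images of the letters of a word, so \<open>hd ws\<close> is the image of its
  first letter. The result is a word over the alphabet of words of length \<open>l\<close>; positions are
  counted from \<open>0\<close>.
\<close>

definition induced_word :: "nat \<Rightarrow> 'a list list \<Rightarrow> 'a list list" where
  "induced_word l ws = map (\<lambda>k. take l (drop k (concat ws))) [0..<length (hd ws)]"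

definition induced_matrix :: "('a \<Rightarrow> 'a list pmf) \<Rightarrow> nat \<Rightarrow> 'a list \<Rightarrow> 'a list \<Rightarrow> real" where
  "induced_matrix P l u v =
    measure_pmf.expectation (subst_blocks P v) (\<lambda>ws. real (occ [u] (induced_word l ws)))"

definition induced_PF_vector :: "('a \<Rightarrow> 'a list pmf) \<Rightarrow> nat \<Rightarrow> 'a list \<Rightarrow> real" where
  "induced_PF_vector P l = PF_right_eigenvector (language_len P l) (induced_matrix P l)"


section \<open>Cylinders and measures on semi-algebras\<close>

definition cylinder :: "('a \<Rightarrow> 'a list pmf) \<Rightarrow> int \<Rightarrow> int \<Rightarrow> 'a list \<Rightarrow> (int \<Rightarrow> 'a) set" where
  "cylinder P k m v = {x \<in> subshift P. window x k m = v}"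

definition cylinders :: "('a \<Rightarrow> 'a list pmf) \<Rightarrow> (int \<Rightarrow> 'a) set set" where
  "cylinders P = {cylinder P k m v | k m v. k \<le> m \<and> v \<in> language_len P (nat (m - k + 1))}"

definition borel_subshift :: "('a \<Rightarrow> 'a list pmf) \<Rightarrow> (int \<Rightarrow> 'a) measure" where
  "borel_subshift P = sigma (subshift P) {U. openin (topology_generated_by (cylinders P)) U}"

definition cylinders0 :: "('a \<Rightarrow> 'a list pmf) \<Rightarrow> (int \<Rightarrow> 'a) set set" where
  "cylinders0 P =
    {cylinder P k m v | k m v. k \<le> 0 \<and> 0 \<le> m \<and> v \<in> language_len P (nat (m - k + 1))}
    \<union> {subshift P, {}}"

definition semialgebra :: "'x set \<Rightarrow> 'x set set \<Rightarrow> bool" where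
  "semialgebra \<Omega> S \<longleftrightarrow> S \<subseteq> Pow \<Omega> \<and> \<Omega> \<in> S \<and> (\<forall>A\<in>S. \<forall>B\<in>S. A \<inter> B \<in> S) \<and>
     (\<forall>A\<in>S. \<exists>C\<subseteq>S. finite C \<and> disjoint C \<and> \<Omega> - A = \<Union>C)"

definition semialgebra_measure :: "'x set \<Rightarrow> 'x set set \<Rightarrow> ('x set \<Rightarrow> ennreal) \<Rightarrow> bool" where
  "semialgebra_measure \<Omega> S \<mu> \<longleftrightarrow> semialgebra \<Omega> S \<and> positive S \<mu> \<and> countably_additive S \<mu>"

definition sigma_finite_on :: "'x set \<Rightarrow> 'x set set \<Rightarrow> ('x set \<Rightarrow> ennreal) \<Rightarrow> bool" where
  "sigma_finite_on \<Omega> S \<mu> \<longleftrightarrow>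
    (\<exists>A :: nat \<Rightarrow> 'x set. range A \<subseteq> S \<and> (\<Union>i. A i) = \<Omega> \<and> (\<forall>i. \<mu> (A i) \<noteq> \<infinity>))"

text \<open>
  The defining equations of the set function on \<open>cylinders0 P\<close>. This is a predicate since
  a cylinder may be represented by several triples \<open>(k, m, v)\<close>, so that the existence of a
  function satisfying the equations is a claim; its values on \<open>cylinders0 P\<close> are determined.
\<close>

definition is_cylinder_function :: "('a \<Rightarrow> 'a list pmf) \<Rightarrow> ((int \<Rightarrow> 'a) set \<Rightarrow> ennreal) \<Rightarrow> bool" where
  "is_cylinder_function P \<mu> \<longleftrightarrow> \<mu> {} = 0 \<and> \<mu> (subshift P) = 1 \<and>
    (\<forall>k m v. k \<le> 0 \<and> 0 \<le> m \<and> v \<in> language_len P (nat (m - k + 1)) \<longrightarrow>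
       \<mu> (cylinder P k m v) = ennreal (induced_PF_vector P (length v) v))"

end

theory Submission
  imports Defs "HOL-Library.Sublist"
begin

text \<open>
  Let \<open>R\<^sub>l\<close> be the Perron--Frobenius vector of the \<open>l\<close>-th induced matrix \<open>M\<^sub>l\<close>. Everything reduces to
  the consistency of the family \<open>R\<^sub>l\<close> under deleting the last or the first letter of a word; a
  probability measure with the prescribed values on cylinders is then a Kolmogorov extension which is
  concentrated on the subshift, and all claims about the set function are read off from that measure.
  In particular the values do not depend on how a cylinder is represented.

  Deleting the last letter of each window intertwines \<open>M\<^bsub>l+1\<^esub>\<close> with \<open>M\<^sub>l\<close>, so the corresponding
  marginal \<open>S\<close> of \<open>R\<^bsub>l+1\<^esub>\<close> is a non-negative eigenvector of \<open>M\<^sub>l\<close>, hence equals \<open>R\<^sub>l\<close>, with the same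
  eigenvalue \<open>r\<close>. Deleting the first letter shifts the windows by one position, which changes the
  counts only at the two ends of the image of the first letter. The marginal \<open>T\<close> therefore satisfies
  \<open>r (T - S) = G (T - S)\<close> with a column-stochastic matrix \<open>G\<close>, and \<open>r > 1\<close> forces \<open>T = S\<close>.
\<close>

section \<open>Primitive matrices over a finite index set\<close>

text \<open>The vector is given by a definite description and the eigenvalue by a supremum over
  complex eigenvalues, so neither can be used before Perron--Frobenius theory on an arbitrary finite
  index set is in place. Its working form: a non-negative normalised eigenvector, for whatever
  eigenvalue, is the Perron--Frobenius vector. To apply it, primitivity of every induced matrix is
  derived from primitivity on letters, and expansion makes the language contain words of every
  length, so that the index sets are non-empty. The asymmetry between the two deletions comes from
  \<open>induced_word\<close>, which lists windows by their starting positions in the image of the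
  first letter: dropping the last letter keeps all of these positions. Both deletions matter because
  an interval of integers can be enlarged on either side. The bound r > 1 is checked directly for
  letters only, where r is an average of expected image lengths, and reaches the other lengths
  through equality of the eigenvalues. Non-emptiness of the subshift is not an input: it follows
  from the limit measure giving it full mass.\<close>

lemma sum_mult_swap:
  fixes h :: "'b \<Rightarrow> 'c :: semiring_0"
  shows "(\<Sum>i\<in>I. f i * (\<Sum>j\<in>J. g i j * h j)) = (\<Sum>j\<in>J. (\<Sum>i\<in>I. f i * g i j) * h j)"
  by (simp add: sum_distrib_left sum_distrib_right mult.assoc) (rule sum.swap)

text \<open>\<open>mat_power\<close> multiplies from the left. The recursion on the other side is
  what makes powers compatible with transposition and lets \<open>M\<close> commute with its
  powers.\<close>

lemma mat_power_Suc_right: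
  assumes "finite I" "i \<in> I" "j \<in> I"
  shows "mat_power I M (Suc n) i j = (\<Sum>k\<in>I. mat_power I M n i k * M k j)"
  using assms(2)
proof (induction n arbitrary: i)
  case 0
  then show ?case using assms(1,3) by (simp add: mult_if_delta if_distrib[of "(*) _"] cong: if_cong)
next
  case (Suc n)
  have "mat_power I M (Suc (Suc n)) i j = (\<Sum>k\<in>I. M i k * mat_power I M (Suc n) k j)"
    by simp
  also have "\<dots> = (\<Sum>k\<in>I. M i k * (\<Sum>l\<in>I. mat_power I M n k l * M l j))"
    using Suc.IH by (intro sum.cong) auto
  also have "\<dots> = (\<Sum>l\<in>I. mat_power I M (Suc n) i l * M l j)"
    by (simp add: sum_distrib_left sum_distrib_right mult.assoc) (rule sum.swap)
  finally show ?case .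
qed

lemma mat_power_transpose:
  assumes "finite I" "i \<in> I" "j \<in> I"
  shows "mat_power I (\<lambda>i j. M j i) n i j = mat_power I M n j i"
  using assms(2,3)
proof (induction n arbitrary: i j)
  case (Suc n)
  then show ?case
    using mat_power_Suc_right[OF assms(1), of j i M n]
    by (simp add: mult.commute del: mat_power.simps(2)) (simp add: mult.commute)
qed auto

lemma mat_power_eigenvector:
  assumes "finite I" "\<And>i. i \<in> I \<Longrightarrow> (\<Sum>j\<in>I. M i j * x j) = s * x i" "i \<in> I"
  shows "(\<Sum>j\<in>I. mat_power I M n i j * x j) = s ^ n * x i"
  using assms(3)
proof (induction n arbitrary: i)
  case 0
  then show ?case using assms(1) by (simp add: mult_if_delta)
next
  case (Suc n)
  have "(\<Sum>j\<in>I. mat_power I M (Suc n) i j * x j)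
      = (\<Sum>k\<in>I. M i k * (\<Sum>j\<in>I. mat_power I M n k j * x j))"
    by (simp add: sum_distrib_left sum_distrib_right mult.assoc) (rule sum.swap)
  also have "\<dots> = (\<Sum>k\<in>I. s ^ n * (M i k * x k))"
    using Suc.IH by (intro sum.cong) auto
  also have "\<dots> = s ^ Suc n * x i"
    using assms(2)[OF Suc.prems] by (simp flip: sum_distrib_left)
  finally show ?case .
qed

locale primitive_index_matrix =
  fixes I :: "'i set" and M :: "'i \<Rightarrow> 'i \<Rightarrow> real"
  assumes finite_index: "finite I" and index_nonempty: "I \<noteq> {}"
    and primitive: "primitive_matrix I M"
begin

lemma entry_nonneg: "i \<in> I \<Longrightarrow> j \<in> I \<Longrightarrow> 0 \<le> M i j"
  using primitive by (auto simp: primitive_matrix_def)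

text \<open>Source of the positive left eigenvector, which later serves as a weight in comparing
  eigenvalues.\<close>

lemma transpose: "primitive_index_matrix I (\<lambda>i j. M j i)"
proof
  show "primitive_matrix I (\<lambda>i j. M j i)"
    using primitive mat_power_transpose[OF finite_index, of _ _ M]
    unfolding primitive_matrix_def by metis
qed (fact finite_index index_nonempty)+

definition "exponent = (SOME n. n > 0 \<and> (\<forall>i\<in>I. \<forall>j\<in>I. 0 < mat_power I M n i j))"

definition "positive_power = mat_power I M exponent"

lemma exponent_pos: "exponent > 0"
  and positive_power_pos: "i \<in> I \<Longrightarrow> j \<in> I \<Longrightarrow> 0 < positive_power i j"
  using someI_ex[of "\<lambda>n. n > 0 \<and> (\<forall>i\<in>I. \<forall>j\<in>I. 0 < mat_power I M n i j)"] primitive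
  by (auto simp: primitive_matrix_def exponent_def positive_power_def)

lemma positive_power_apply_pos:
  assumes "\<And>j. j \<in> I \<Longrightarrow> 0 \<le> x j" "k \<in> I" "0 < x k" "i \<in> I"
  shows "0 < (\<Sum>j\<in>I. positive_power i j * x j)"
  using assms finite_index positive_power_pos[OF \<open>i \<in> I\<close>]
  by (intro sum_pos2[of I k]) (auto simp: less_imp_le)

text \<open>Applying the positive power to \<open>x\<close> multiplies it by a power of
  \<open>s\<close> and makes every coordinate positive, so neither \<open>s\<close> nor any
  coordinate can vanish.\<close>

lemma nonneg_eigenvector_pos:
  assumes eig: "\<And>i. i \<in> I \<Longrightarrow> (\<Sum>j\<in>I. M i j * x j) = s * x i"
    and nn: "\<And>i. i \<in> I \<Longrightarrow> 0 \<le> x i" and k: "k \<in> I" "x k \<noteq> 0"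
  shows "0 < s" and "i \<in> I \<Longrightarrow> 0 < x i"
proof -
  have *: "0 < s ^ exponent * x i" if "i \<in> I" for i
  proof -
    have "0 < x k" using nn[OF k(1)] k(2) by simp
    then have "0 < (\<Sum>j\<in>I. positive_power i j * x j)"
      using nn k(1) that by (intro positive_power_apply_pos[of x k i])
    also have "\<dots> = s ^ exponent * x i"
      unfolding positive_power_def using eig that by (intro mat_power_eigenvector finite_index)
    finally show ?thesis .
  qed
  have pos: "0 < x i" if "i \<in> I" for i
    using *[OF that] nn[OF that] by (cases "x i = 0") auto
  then show "i \<in> I \<Longrightarrow> 0 < x i" .
  have "0 \<le> s * x k"
    unfolding eig[OF k(1), symmetric] using entry_nonneg nn k by (intro sum_nonneg) auto
  then have "0 \<le> s" using pos[OF k(1)] by (simp add: zero_le_mult_iff)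
  \<comment> \<open>Positivity of the exponent matters: with exponent 0 the factor would be 1 even
    for \<open>s = 0\<close>.\<close>
  moreover have "s \<noteq> 0" using *[OF k(1)] exponent_pos by (auto simp: power_0_left)
  ultimately show "0 < s" by simp
qed

text \<open>
  Collatz--Wielandt: \<open>t\<close> is maximal among the numbers with \<open>t x \<le> M x\<close> for some \<open>x\<close> in the simplex,
  and if equality failed, applying the positive power to \<open>M x - t x\<close> would allow a larger \<open>t\<close>.
\<close>

lemma ex_positive_eigenvector:
  "\<exists>s x. (\<forall>i\<in>I. 0 < x i) \<and> (\<forall>i\<in>I. (\<Sum>j\<in>I. M i j * x j) = s * x i)"
proof -
  \<comment> \<open>Summing \<open>t x \<le> M x\<close> over all coordinates of a probability
    vector bounds \<open>t\<close> by the sum of all entries, so the admissible pairs stay in a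
    compact set.\<close>
  define B where "B = (\<Sum>i\<in>I. \<Sum>j\<in>I. M i j)"
  have B: "0 \<le> B" unfolding B_def by (intro sum_nonneg entry_nonneg)
  \<comment> \<open>Coordinates outside \<open>I\<close> are pinned to 0, which makes this a compact
    box in the space of all functions although the type \<open>'i\<close> may be infinite.\<close>
  define C where "C = (PiE UNIV (\<lambda>i. if i \<in> I then {0..1} else {0}) :: ('i \<Rightarrow> real) set) \<times> {0..B}"
  define S where "S = C \<inter> {p. (\<Sum>i\<in>I. fst p i) = 1} \<inter>
    (\<Inter>i\<in>I. {p. snd p * fst p i \<le> (\<Sum>j\<in>I. M i j * fst p j)})"
  have "compactin (product_topology (\<lambda>i. euclidean) UNIV)
      (PiE UNIV (\<lambda>i. if i \<in> I then {0..1} else {0}) :: ('i \<Rightarrow> real) set)"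
    by (subst compactin_PiE) auto
  then have "compact (PiE UNIV (\<lambda>i. if i \<in> I then {0..1} else {0}) :: ('i \<Rightarrow> real) set)"
    by (simp add: euclidean_product_topology)
  then have "compact C" unfolding C_def by (intro compact_Times) auto
  have [continuous_intros]: "continuous_on A (\<lambda>p. fst p i)" for A :: "(('i \<Rightarrow> real) \<times> real) set" and i
    by (intro continuous_on_compose2[OF continuous_on_product_coordinates continuous_on_fst[OF continuous_on_id]])
      auto
  have "compact S" unfolding S_def
    by (intro compact_Int_closed \<open>compact C\<close> closed_INT ballI closed_Collect_le closed_Collect_eq
        continuous_intros)
  define c where "c = card I"
  have c: "0 < real c" using finite_index index_nonempty by (simp add: c_def card_gt_0_iff)
  have memS: "(x, t) \<in> S" if "\<And>i. i \<in> I \<Longrightarrow> 0 \<le> x i" "\<And>i. i \<notin> I \<Longrightarrow> x i = 0" "(\<Sum>i\<in>I. x i) = 1" "0 \<le> t"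
     "\<And>i. i \<in> I \<Longrightarrow> t * x i \<le> (\<Sum>j\<in>I. M i j * x j)" for x t
  proof -
    have le1: "x i \<le> 1" if i: "i \<in> I" for i
      using member_le_sum[OF i _ finite_index, of x] that i \<open>(\<Sum>i\<in>I. x i) = 1\<close>
        \<open>\<And>i. i \<in> I \<Longrightarrow> 0 \<le> x i\<close> by auto
    have "t = (\<Sum>i\<in>I. t * x i)" using that by (simp flip: sum_distrib_left)
    also have "\<dots> \<le> (\<Sum>i\<in>I. \<Sum>j\<in>I. M i j * x j)" using that by (intro sum_mono)
    also have "\<dots> \<le> B" unfolding B_def
      using entry_nonneg le1 by (intro sum_mono mult_left_le) auto
    finally show ?thesis using that le1 by (auto simp: S_def C_def)
  qed
  have "((\<lambda>i. if i \<in> I then 1 / c else 0), 0) \<in> S"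
    using c finite_index entry_nonneg by (intro memS) (auto simp: c_def intro!: sum_nonneg)
  then have "S \<noteq> {}" by auto
  from continuous_attains_sup[OF \<open>compact S\<close> this continuous_on_snd[OF continuous_on_id]]
  obtain p where p: "p \<in> S" "\<forall>q\<in>S. snd q \<le> snd p"
    by blast
  obtain x t where "p = (x, t)" by (cases p)
  with p have xt: "(x, t) \<in> S" and max: "\<And>y s. (y, s) \<in> S \<Longrightarrow> s \<le> t"
    by auto
  have x: "x i \<ge> 0" "t * x i \<le> (\<Sum>j\<in>I. M i j * x j)" if "i \<in> I" for i
    using xt that by (auto simp: S_def C_def PiE_iff split: if_splits dest!: spec[of _ i])
  have t: "0 \<le> t" and sum1: "(\<Sum>i\<in>I. x i) = 1" using xt by (auto simp: S_def C_def)
  obtain k where "k \<in> I" "x k \<noteq> 0"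
    using sum1 by (metis sum.neutral zero_neq_one)
  then have k: "k \<in> I" "x k > 0" using x(1)[of k] by auto
  define d where "d i = (\<Sum>j\<in>I. M i j * x j) - t * x i" for i
  have "d i = 0" if i: "i \<in> I" for i
  proof (rule ccontr)
    assume "d i \<noteq> 0"
    then have "d i > 0" using x[OF i] by (simp add: d_def)
    \<comment> \<open>Since \<open>M\<close> commutes with its power, the defect
      \<open>M y - t y\<close> is the positive power applied to \<open>d\<close>; one positive
      coordinate of \<open>d\<close> thus makes every coordinate of the new defect positive.\<close>
    define y where "y i = (\<Sum>j\<in>I. positive_power i j * x j)" for i
    have y: "y j > 0" if "j \<in> I" for j
      unfolding y_def using positive_power_apply_pos[of x k j] x k that by auto
    have My: "(\<Sum>l\<in>I. M j l * y l) - t * y j > 0" if "j \<in> I" for j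
    proof -
      have "0 < (\<Sum>l\<in>I. positive_power j l * d l)"
        using positive_power_apply_pos[of d i j] x i \<open>d i > 0\<close> that by (auto simp: d_def)
      also have "\<dots> = (\<Sum>l\<in>I. positive_power j l * (\<Sum>m\<in>I. M l m * x m)) - t * y j"
      proof -
        have "(\<Sum>l\<in>I. positive_power j l * (t * x l)) = t * y j"
          unfolding y_def sum_distrib_left by (intro sum.cong) auto
        then show ?thesis by (simp add: d_def right_diff_distrib sum_subtractf)
      qed
      also have "(\<Sum>l\<in>I. positive_power j l * (\<Sum>m\<in>I. M l m * x m))
          = (\<Sum>m\<in>I. (\<Sum>l\<in>I. positive_power j l * M l m) * x m)"
        by (rule sum_mult_swap)
      also have "\<dots> = (\<Sum>m\<in>I. (\<Sum>l\<in>I. M j l * positive_power l m) * x m)"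
        unfolding positive_power_def
        by (intro sum.cong refl)
          (simp only: mat_power_Suc_right[OF finite_index that, of _ M, symmetric] mat_power.simps(2))
      also have "\<dots> = (\<Sum>l\<in>I. M j l * y l)"
        by (simp add: y_def sum_distrib_left sum_distrib_right mult.assoc) (rule sum.swap)
      finally show ?thesis .
    qed
    \<comment> \<open>The largest amount by which \<open>t\<close> can be raised with
      \<open>y\<close> still satisfying the inequality in all coordinates.\<close>
    define e where "e = Min ((\<lambda>j. ((\<Sum>l\<in>I. M j l * y l) - t * y j) / y j) ` I)"
    have e: "e > 0" unfolding e_def using finite_index index_nonempty My y
      by (subst Min_gr_iff) auto
    have ele: "e \<le> ((\<Sum>l\<in>I. M j l * y l) - t * y j) / y j" if "j \<in> I" for j
      unfolding e_def using finite_index that by (intro Min_le) auto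
    define s where "s = (\<Sum>i\<in>I. y i)"
    have s: "s > 0" unfolding s_def using y finite_index index_nonempty by (intro sum_pos) auto
    have "((\<lambda>i. if i \<in> I then y i / s else 0), t + e) \<in> S"
    proof (rule memS)
      show "(\<Sum>i\<in>I. if i \<in> I then y i / s else 0) = 1"
        using s by (simp add: s_def flip: sum_divide_distrib)
      fix j assume j: "j \<in> I"
      have "e * y j \<le> (\<Sum>l\<in>I. M j l * y l) - t * y j"
        using ele[OF j] y[OF j] by (simp add: pos_le_divide_eq)
      then have "(t + e) * y j / s \<le> (\<Sum>l\<in>I. M j l * y l) / s"
        using s by (intro divide_right_mono) (auto simp: algebra_simps)
      then show "(t + e) * (if j \<in> I then y j / s else 0) \<le> (\<Sum>l\<in>I. M j l * (if l \<in> I then y l / s else 0))"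
        using j by (simp add: sum_divide_distrib)
    qed (use y s t e in \<open>auto intro: less_imp_le\<close>)
    from max[OF this] e show False by simp
  qed
  then have eig: "\<And>i. i \<in> I \<Longrightarrow> (\<Sum>j\<in>I. M i j * x j) = t * x i" by (simp add: d_def)
  have "0 < x i" if "i \<in> I" for i
    by (rule nonneg_eigenvector_pos(2)[of x t k, OF eig x(1) k(1)]) (use k(2) that in auto)
  with eig show ?thesis by blast
qed

lemma ex_positive_left_eigenvector:
  "\<exists>s x. (\<forall>i\<in>I. 0 < x i) \<and> (\<forall>j\<in>I. (\<Sum>i\<in>I. x i * M i j) = s * x j)"
  using primitive_index_matrix.ex_positive_eigenvector[OF transpose] by (simp add: mult.commute)

text \<open>Subtract from \<open>y\<close> the largest multiple of \<open>x\<close> lying below it.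
  The difference is a non-negative eigenvector with a zero coordinate, hence zero by
  \<open>nonneg_eigenvector_pos\<close>.\<close>

lemma nonneg_eigenvectors_proportional:
  assumes "\<And>i. i \<in> I \<Longrightarrow> 0 < x i" "\<And>i. i \<in> I \<Longrightarrow> (\<Sum>j\<in>I. M i j * x j) = s * x i"
    and "\<And>i. i \<in> I \<Longrightarrow> 0 \<le> y i" "\<And>i. i \<in> I \<Longrightarrow> (\<Sum>j\<in>I. M i j * y j) = s * y i"
  obtains c where "\<And>i. i \<in> I \<Longrightarrow> y i = c * x i"
proof -
  define c where "c = Min ((\<lambda>i. y i / x i) ` I)"
  have cle: "c \<le> y i / x i" if "i \<in> I" for i
    unfolding c_def using finite_index that by (intro Min_le) auto
  have "c \<in> (\<lambda>i. y i / x i) ` I"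
    unfolding c_def using finite_index index_nonempty by (intro Min_in) auto
  then obtain k where k: "k \<in> I" "c = y k / x k" by auto
  define z where "z i = y i - c * x i" for i
  have zk: "z k = 0" using k assms(1)[OF k(1)] by (simp add: z_def)
  have z_nonneg: "0 \<le> z i" if "i \<in> I" for i
    using cle[OF that] assms(1)[OF that] by (simp add: z_def pos_le_divide_eq)
  have "(\<Sum>j\<in>I. M i j * z j) = s * z i" if "i \<in> I" for i
    using assms(2,4)[OF that]
    by (simp add: z_def right_diff_distrib sum_subtractf mult.left_commute flip: sum_distrib_left)
  from nonneg_eigenvector_pos(2)[OF this z_nonneg _ _ k(1)] zk
  have "z i = 0" if "i \<in> I" for i using that by force
  then show ?thesis by (intro that[of c]) (simp add: z_def)
qed

text \<open>The pairing of the positive left vector \<open>x\<close> with \<open>y\<close> is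
  positive, and evaluating it with \<open>M\<close> in between yields both \<open>s\<close> and
  \<open>t\<close> times it.\<close>

lemma eigenvalues_eq:
  assumes x: "\<And>i. i \<in> I \<Longrightarrow> 0 < x i" "\<And>j. j \<in> I \<Longrightarrow> (\<Sum>i\<in>I. x i * M i j) = s * x j"
    and y: "\<And>i. i \<in> I \<Longrightarrow> 0 \<le> y i" "k \<in> I" "y k \<noteq> 0"
      "\<And>i. i \<in> I \<Longrightarrow> (\<Sum>j\<in>I. M i j * y j) = t * y i"
  shows "s = t"
proof -
  have "t * (\<Sum>i\<in>I. x i * y i) = (\<Sum>i\<in>I. x i * (\<Sum>j\<in>I. M i j * y j))"
    using y(4) by (simp add: sum_distrib_left mult.left_commute)
  also have "\<dots> = (\<Sum>j\<in>I. (\<Sum>i\<in>I. x i * M i j) * y j)"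
    by (rule sum_mult_swap)
  also have "\<dots> = s * (\<Sum>i\<in>I. x i * y i)"
    using x(2) by (simp add: sum_distrib_left mult.assoc)
  finally have "t * (\<Sum>i\<in>I. x i * y i) = s * (\<Sum>i\<in>I. x i * y i)" .
  moreover have "0 < (\<Sum>i\<in>I. x i * y i)"
    using x(1) y(1-3) finite_index
    by (intro sum_pos2[of I k]) (auto simp: less_imp_le less_le[of 0 "y k"])
  ultimately show ?thesis by simp
qed

text \<open>By \<open>eigenvalues_eq\<close>, \<open>t\<close> is also the eigenvalue of a positive
  left eigenvector. Weighting the triangle inequality for any complex eigenvector with that left
  vector bounds the modulus of its eigenvalue by \<open>t\<close>, so the supremum is attained at
  \<open>t\<close>.\<close>

lemma PF_eigenvalue_eqI:
  assumes y: "\<And>i. i \<in> I \<Longrightarrow> 0 \<le> y i" "k \<in> I" "y k \<noteq> 0"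
      "\<And>i. i \<in> I \<Longrightarrow> (\<Sum>j\<in>I. M i j * y j) = t * y i"
  shows "PF_eigenvalue I M = t"
proof -
  obtain s x where x: "\<And>i. i \<in> I \<Longrightarrow> 0 < x i" "\<And>j. j \<in> I \<Longrightarrow> (\<Sum>i\<in>I. x i * M i j) = s * x j"
    using ex_positive_left_eigenvector by blast
  have [simp]: "s = t" by (rule eigenvalues_eq[OF x y])
  have t: "0 < t" by (rule nonneg_eigenvector_pos(1)[OF y(4,1,2,3)])
  have "of_real t \<in> eigenvalues I M"
    unfolding eigenvalues_def using y
    by (auto intro!: exI[of _ "\<lambda>i. of_real (y i)"] simp flip: of_real_mult of_real_sum)
  then have "t \<in> cmod ` eigenvalues I M" using t by (force simp: image_iff)
  moreover have "cmod z \<le> t" if "z \<in> eigenvalues I M" for z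
  proof -
    from that obtain w i where w: "i \<in> I" "w i \<noteq> 0" "\<And>i. i \<in> I \<Longrightarrow> (\<Sum>j\<in>I. of_real (M i j) * w j) = z * w i"
      unfolding eigenvalues_def by blast
    have "cmod z * (\<Sum>i\<in>I. x i * cmod (w i)) = (\<Sum>i\<in>I. x i * cmod (\<Sum>j\<in>I. of_real (M i j) * w j))"
      using w(3) by (simp add: sum_distrib_left norm_mult mult.left_commute)
    also have "\<dots> \<le> (\<Sum>i\<in>I. x i * (\<Sum>j\<in>I. M i j * cmod (w j)))"
      using x(1) entry_nonneg
      by (intro sum_mono mult_left_mono sum_norm_le) (auto simp: norm_mult less_imp_le)
    also have "\<dots> = (\<Sum>j\<in>I. (\<Sum>i\<in>I. x i * M i j) * cmod (w j))"
      by (rule sum_mult_swap)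
    also have "\<dots> = t * (\<Sum>i\<in>I. x i * cmod (w i))"
      using x(2) by (simp add: sum_distrib_left mult.assoc)
    finally have "cmod z * (\<Sum>i\<in>I. x i * cmod (w i)) \<le> t * (\<Sum>i\<in>I. x i * cmod (w i))" .
    moreover have "0 < (\<Sum>i\<in>I. x i * cmod (w i))"
      using x(1) w(1,2) finite_index by (intro sum_pos2[of I i]) (auto simp: less_imp_le)
    ultimately show ?thesis by simp
  qed
  ultimately show ?thesis unfolding PF_eigenvalue_def by (intro cSup_eq_maximum) auto
qed

text \<open>The eigenvalue \<open>t\<close> is left free: non-negativity forces it to be the
  spectral radius, and proportionality with the normalisation then pins down the vector. Marginals
  of longer vectors are recognised through this rule.\<close>

lemma PF_right_eigenvector_eqI:
  assumes y: "\<And>i. i \<in> I \<Longrightarrow> 0 \<le> y i" "\<And>i. i \<notin> I \<Longrightarrow> y i = 0" "(\<Sum>i\<in>I. y i) = 1"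
      "\<And>i. i \<in> I \<Longrightarrow> (\<Sum>j\<in>I. M i j * y j) = t * y i"
  shows "PF_right_eigenvector I M = y"
proof -
  obtain k where k: "k \<in> I" "y k \<noteq> 0"
    using y(3) by (metis sum.neutral zero_neq_one)
  have pos: "0 < y i" if "i \<in> I" for i
    by (rule nonneg_eigenvector_pos(2)[of y t k, OF y(4,1) k that])
  have PF: "PF_eigenvalue I M = t"
    by (rule PF_eigenvalue_eqI[of y k t]) (use k y in auto)
  show ?thesis unfolding PF_right_eigenvector_def PF
  proof (rule the_equality)
    show "(\<forall>i\<in>I. 0 < y i) \<and> (\<forall>i. i \<notin> I \<longrightarrow> y i = 0) \<and>
      (\<forall>i\<in>I. (\<Sum>j\<in>I. M i j * y j) = t * y i) \<and> (\<Sum>i\<in>I. \<bar>y i\<bar>) = 1"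
      using y pos by auto
    fix x :: "'i \<Rightarrow> real"
    assume *: "(\<forall>i\<in>I. 0 < x i) \<and> (\<forall>i. i \<notin> I \<longrightarrow> x i = 0) \<and>
      (\<forall>i\<in>I. (\<Sum>j\<in>I. M i j * x j) = t * x i) \<and> (\<Sum>i\<in>I. \<bar>x i\<bar>) = 1"
    then obtain c where c: "\<And>i. i \<in> I \<Longrightarrow> x i = c * y i"
      using nonneg_eigenvectors_proportional[of y t x, OF pos y(4)] by (auto intro: less_imp_le)
    have "(\<Sum>i\<in>I. x i) = (\<Sum>i\<in>I. \<bar>x i\<bar>)" using * by (intro sum.cong) auto
    then have "c * (\<Sum>i\<in>I. y i) = 1" using * c by (simp add: sum_distrib_left)
    then have "c = 1" using y(3) by simp
    then have "x i = y i" for i using c[of i] * y(2)[of i] by (cases "i \<in> I") auto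
    then show "x = y" by blast
  qed
qed

lemma PF_right_eigenvector:
  shows PF_right_eigenvector_pos: "\<And>i. i \<in> I \<Longrightarrow> 0 < PF_right_eigenvector I M i"
    and PF_right_eigenvector_outside: "\<And>i. i \<notin> I \<Longrightarrow> PF_right_eigenvector I M i = 0"
    and sum_PF_right_eigenvector: "(\<Sum>i\<in>I. PF_right_eigenvector I M i) = 1"
    and PF_right_eigenvector_eigen: "\<And>i. i \<in> I \<Longrightarrow>
      (\<Sum>j\<in>I. M i j * PF_right_eigenvector I M j) = PF_eigenvalue I M * PF_right_eigenvector I M i"
proof -
  obtain s x where x: "\<And>i. i \<in> I \<Longrightarrow> 0 < x i" "\<And>i. i \<in> I \<Longrightarrow> (\<Sum>j\<in>I. M i j * x j) = s * x i"
    using ex_positive_eigenvector by blast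
  define c where "c = (\<Sum>i\<in>I. x i)"
  have c: "c > 0" unfolding c_def using x(1) finite_index index_nonempty by (intro sum_pos) auto
  define y where "y i = (if i \<in> I then x i / c else 0)" for i
  have eig: "(\<Sum>j\<in>I. M i j * y j) = s * y i" if "i \<in> I" for i
    using x(2)[OF that] that by (simp add: y_def flip: sum_divide_distrib)
  have pos: "0 < y i" if "i \<in> I" for i using x(1)[OF that] c that by (simp add: y_def)
  have zero: "y i = 0" if "i \<notin> I" for i using that by (simp add: y_def)
  have sum1: "(\<Sum>i\<in>I. y i) = 1" using c by (simp add: y_def c_def flip: sum_divide_distrib)
  have R: "PF_right_eigenvector I M = y"
    by (rule PF_right_eigenvector_eqI[OF less_imp_le[OF pos] zero sum1 eig])
  obtain k where "k \<in> I" using index_nonempty by blast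
  have l: "PF_eigenvalue I M = s"
    using pos[OF \<open>k \<in> I\<close>] by (intro PF_eigenvalue_eqI[OF less_imp_le[OF pos] \<open>k \<in> I\<close> _ eig]) auto
  show "\<And>i. i \<in> I \<Longrightarrow> 0 < PF_right_eigenvector I M i"
    "\<And>i. i \<notin> I \<Longrightarrow> PF_right_eigenvector I M i = 0"
    "(\<Sum>i\<in>I. PF_right_eigenvector I M i) = 1"
    "\<And>i. i \<in> I \<Longrightarrow>
      (\<Sum>j\<in>I. M i j * PF_right_eigenvector I M j) = PF_eigenvalue I M * PF_right_eigenvector I M i"
    using pos zero sum1 eig by (simp_all add: R l)
qed

end

section \<open>Images of words and primitivity of the induced matrix\<close>

lemma expectation_pmf_cong:
  fixes f g :: "'b \<Rightarrow> real"
  assumes "\<And>x. x \<in> set_pmf p \<Longrightarrow> f x = g x"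
  shows "measure_pmf.expectation p f = measure_pmf.expectation p g"
  using assms by (intro integral_cong_AE) (auto simp: AE_measure_pmf_iff)

lemma expectation_pmf_pos:
  fixes f :: "'b \<Rightarrow> real"
  assumes "finite (set_pmf p)" "\<And>x. x \<in> set_pmf p \<Longrightarrow> 0 \<le> f x" "y \<in> set_pmf p" "0 < f y"
  shows "0 < measure_pmf.expectation p f"
proof -
  have "measure_pmf.expectation p f = (\<Sum>x\<in>set_pmf p. f x * pmf p x)"
    using assms(1) by (intro integral_measure_pmf_real) auto
  also have "0 < \<dots>"
    using assms by (intro sum_pos2[of _ y]) (auto simp: pmf_positive)
  finally show ?thesis .
qed

lemma expectation_pmf_pos_imp_ex:
  fixes f :: "'b \<Rightarrow> real"
  assumes "0 < measure_pmf.expectation p f"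
  obtains x where "x \<in> set_pmf p" "f x \<noteq> 0"
proof (rule ccontr)
  assume "\<not> thesis"
  then have "measure_pmf.expectation p f = measure_pmf.expectation p (\<lambda>_. 0)"
    using that by (intro expectation_pmf_cong) auto
  then show False using assms by simp
qed

lemma occ_pos_iff: "1 \<le> occ v u \<longleftrightarrow> sublist v u"
proof -
  have "finite {i. i + length v \<le> length u \<and> take (length v) (drop i u) = v}"
    by (rule finite_subset[of _ "{..length u}"]) auto
  then have "1 \<le> occ v u \<longleftrightarrow> (\<exists>i. i + length v \<le> length u \<and> take (length v) (drop i u) = v)"
    unfolding occ_def by (auto simp: Suc_le_eq card_gt_0_iff)
  also have "\<dots> \<longleftrightarrow> sublist v u"
  proof
    assume "\<exists>i. i + length v \<le> length u \<and> take (length v) (drop i u) = v"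
    then obtain i where "take (length v) (drop i u) = v" by blast
    then have "u = take i u @ v @ drop (length v) (drop i u)"
      by (metis append_take_drop_id)
    then show "sublist v u" unfolding sublist_def by blast
  next
    assume "sublist v u"
    then obtain ps ss where "u = ps @ v @ ss" by (auto simp: sublist_def)
    then show "\<exists>i. i + length v \<le> length u \<and> take (length v) (drop i u) = v"
      by (intro exI[of _ "length ps"]) auto
  qed
  finally show ?thesis .
qed

lemma occ_singleton: "occ [x] w = card {i. i < length w \<and> w ! i = x}"
  unfolding occ_def by (rule arg_cong[where f=card]) (auto simp: take_Suc_conv_app_nth Suc_le_eq)

lemma sublist_take_drop: "sublist (take n (drop m xs)) xs"
  by (rule sublist_order.order.trans[OF sublist_take sublist_drop])

lemma concat_position:
  assumes "p < length (concat ws)"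
  obtains q r where "q < length ws" "r < length (ws ! q)" "p = length (concat (take q ws)) + r"
  using assms
proof (induction ws arbitrary: p thesis)
  case (Cons w ws)
  show ?case
  proof (cases "p < length w")
    case True
    then show ?thesis using Cons.prems(1)[of 0 p] by simp
  next
    case False
    then obtain q r where "q < length ws" "r < length (ws ! q)"
      "p - length w = length (concat (take q ws)) + r"
      using Cons.IH[of "p - length w" thesis] Cons.prems(2) by fastforce
    then show ?thesis using Cons.prems(1)[of "Suc q" r] False by simp
  qed
qed simp

text \<open>Equals \<open>occ [u] (induced_word l ws)\<close>; as a set of starting positions it can
  be manipulated by counting.\<close>

definition window_count :: "nat \<Rightarrow> 'a list list \<Rightarrow> 'a list \<Rightarrow> nat" where
  "window_count l ws u = card {k. k < length (hd ws) \<and> take l (drop k (concat ws)) = u}"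

lemma induced_matrix_eq:
  "induced_matrix P l u v = measure_pmf.expectation (subst_blocks P v) (\<lambda>ws. real (window_count l ws u))"
  unfolding induced_matrix_def occ_singleton induced_word_def window_count_def
  by (intro arg_cong[where f="measure_pmf.expectation _"] ext arg_cong[where f=real] arg_cong[where f=card])
     auto

section \<open>Supports of iterated images, legal words and legal windows\<close>

context random_substitution
begin

lemma set_subst_blocks:
  "ws \<in> set_pmf (subst_blocks P u) \<longleftrightarrow> list_all2 (\<lambda>w a. w \<in> set_pmf (P a)) ws u"
proof (induction u arbitrary: ws)
  case (Cons a u)
  then show ?case by (cases ws) (auto simp: image_iff)
qed auto

lemma finite_subst_blocks: "finite (set_pmf (subst_blocks P u))"
  by (induction u) (auto simp: finite_support)

lemma subst_blocks_length: "ws \<in> set_pmf (subst_blocks P u) \<Longrightarrow> length ws = length u"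
  by (auto simp: set_subst_blocks dest: list_all2_lengthD)

lemma subst_blocks_nonempty: "ws \<in> set_pmf (subst_blocks P u) \<Longrightarrow> [] \<notin> set ws"
  using nonempty_image by (auto simp: set_subst_blocks list_all2_conv_all_nth in_set_conv_nth)

lemma length_concat_ge: "[] \<notin> set ws \<Longrightarrow> length ws \<le> length (concat ws)"
proof (induction ws)
  case (Cons w ws)
  then show ?case by (cases w) auto
qed simp

lemma set_subst_word:
  "set_pmf (subst_word P u) = concat ` set_pmf (subst_blocks P u)"
  unfolding subst_word_def by (rule set_map_pmf)

lemma set_subst_word_append:
  "w \<in> set_pmf (subst_word P (u @ v)) \<longleftrightarrow>
    (\<exists>x\<in>set_pmf (subst_word P u). \<exists>y\<in>set_pmf (subst_word P v). w = x @ y)"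
  unfolding set_subst_word
proof
  assume "w \<in> concat ` set_pmf (subst_blocks P (u @ v))"
  then obtain us vs where "us \<in> set_pmf (subst_blocks P u)" "vs \<in> set_pmf (subst_blocks P v)"
    "w = concat (us @ vs)"
    unfolding image_iff Bex_def set_subst_blocks list_all2_append2 by blast
  then show "\<exists>x\<in>concat ` set_pmf (subst_blocks P u). \<exists>y\<in>concat ` set_pmf (subst_blocks P v). w = x @ y"
    by auto
next
  assume "\<exists>x\<in>concat ` set_pmf (subst_blocks P u). \<exists>y\<in>concat ` set_pmf (subst_blocks P v). w = x @ y"
  then obtain ws ws' where "ws \<in> set_pmf (subst_blocks P u)" "ws' \<in> set_pmf (subst_blocks P v)"
    "w = concat (ws @ ws')" by auto
  then show "w \<in> concat ` set_pmf (subst_blocks P (u @ v))"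
    by (intro image_eqI[of _ _ "ws @ ws'"]) (auto simp: set_subst_blocks intro: list_all2_appendI)
qed

text \<open>The concatenation rule for the chain is stated for supports only, which suffices for all
  positivity arguments and avoids a joint realisation of the letter chains.\<close>

lemma set_subst_iter_append:
  "w \<in> set_pmf (subst_iter P n (u @ v)) \<longleftrightarrow>
    (\<exists>x\<in>set_pmf (subst_iter P n u). \<exists>y\<in>set_pmf (subst_iter P n v). w = x @ y)"
proof (induction n arbitrary: w)
  case (Suc n)
  have "w \<in> set_pmf (subst_iter P (Suc n) (u @ v)) \<longleftrightarrow>
      (\<exists>x\<in>set_pmf (subst_iter P n u). \<exists>y\<in>set_pmf (subst_iter P n v). w \<in> set_pmf (subst_word P (x @ y)))"
    using Suc.IH by (simp add: Bex_def) blast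
  then show ?case by (auto simp: set_subst_word_append)
qed auto

lemma subst_iter_appendI:
  "x \<in> set_pmf (subst_iter P n u) \<Longrightarrow> y \<in> set_pmf (subst_iter P n v) \<Longrightarrow>
    x @ y \<in> set_pmf (subst_iter P n (u @ v))"
  using set_subst_iter_append by blast

lemma subst_word_length: "w \<in> set_pmf (subst_word P u) \<Longrightarrow> length u \<le> length w"
  using length_concat_ge subst_blocks_nonempty subst_blocks_length
  by (fastforce simp: set_subst_word)

lemma subst_iter_length: "w \<in> set_pmf (subst_iter P n u) \<Longrightarrow> length u \<le> length w"
  by (induction n arbitrary: w) (auto dest: subst_word_length order.trans)

lemma subst_iter_add:
  "w \<in> set_pmf (subst_iter P m u) \<Longrightarrow> x \<in> set_pmf (subst_iter P n w) \<Longrightarrow>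
    x \<in> set_pmf (subst_iter P (m + n) u)"
  by (induction n arbitrary: x) auto

lemma subst_iter_ex: "\<exists>w. w \<in> set_pmf (subst_iter P n u)"
  using set_pmf_not_empty[of "subst_iter P n u"] by auto

lemma in_language_iff:
  "u \<in> language P \<longleftrightarrow> u \<noteq> [] \<and> (\<exists>v n a. v \<in> set_pmf (subst_iter P n [a]) \<and> sublist u v)"
  by (simp add: language_def occ_pos_iff pmf_positive_iff del: One_nat_def)

lemma language_sublist: "u \<in> language P \<Longrightarrow> sublist v u \<Longrightarrow> v \<noteq> [] \<Longrightarrow> v \<in> language P"
  unfolding in_language_iff using sublist_order.order.trans by blast

lemma language_letter: "[a] \<in> language P"
  unfolding in_language_iff by (auto intro!: exI[of _ "[a]"] exI[of _ 0])

text \<open>The context around \<open>u\<close> may be given any images of positive probability,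
  since the two sides evolve separately.\<close>

lemma subst_iter_sublist:
  assumes "sublist u v" "w \<in> set_pmf (subst_iter P n u)"
  obtains x where "x \<in> set_pmf (subst_iter P n v)" "sublist w x"
proof -
  obtain ps ss where v: "v = ps @ u @ ss" using assms(1) by (auto simp: sublist_def)
  obtain p s where "p \<in> set_pmf (subst_iter P n ps)" "s \<in> set_pmf (subst_iter P n ss)"
    using subst_iter_ex[of n ps] subst_iter_ex[of n ss] by blast
  then have "p @ w @ s \<in> set_pmf (subst_iter P n v)"
    unfolding v by (intro subst_iter_appendI assms(2))
  then show ?thesis by (rule that) (auto simp: sublist_def)
qed

lemma language_subst:
  assumes "v \<in> language P" "w \<in> set_pmf (subst_iter P n v)"
  shows "w \<in> language P"
proof -
  obtain x m a where x: "x \<in> set_pmf (subst_iter P m [a])" "sublist v x" "v \<noteq> []"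
    using assms(1) by (auto simp: in_language_iff)
  obtain y where "y \<in> set_pmf (subst_iter P n x)" "sublist w y"
    using subst_iter_sublist[OF x(2) assms(2)] .
  moreover have "w \<noteq> []" using subst_iter_length[OF assms(2)] x(3) by auto
  ultimately show ?thesis using subst_iter_add[OF x(1)] unfolding in_language_iff by blast
qed

lemma finite_language_len: "finite (language_len P l)"
  by (rule finite_subset[OF _ finite_lists_length_eq[of UNIV l]]) (auto simp: language_len_def)

text \<open>The window has full length because each of the \<open>l - 1\<close> letters after the
  first contributes at least one letter to the image.\<close>

lemma language_len_window:
  assumes "v \<in> language_len P l" "0 < l" "ws \<in> set_pmf (subst_blocks P v)" "k < length (hd ws)"
  shows "take l (drop k (concat ws)) \<in> language_len P l"
proof -
  have v: "v \<in> language P" "length v = l" using assms by (auto simp: language_len_def)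
  have "concat ws \<in> language P"
    using language_subst[OF v(1), of "concat ws" 1] assms(3) by (simp add: set_subst_word)
  moreover obtain w ws' where ws: "ws = w # ws'"
    using assms subst_blocks_length[OF assms(3)] v by (cases ws) auto
  have "l - 1 \<le> length (concat ws')"
    using length_concat_ge[of ws'] subst_blocks_nonempty[OF assms(3)] subst_blocks_length[OF assms(3)] v
    by (simp add: ws)
  then have "length (take l (drop k (concat ws))) = l" using assms ws by auto
  ultimately show ?thesis using assms(2)
    by (auto simp: language_len_def simp del: length_take length_drop
        intro!: language_sublist[OF _ sublist_take_drop])
qed

lemma induced_matrix_posI:
  assumes "ws \<in> set_pmf (subst_blocks P v)" "k < length (hd ws)"
  shows "0 < induced_matrix P l (take l (drop k (concat ws))) v"
  unfolding induced_matrix_eq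
proof (rule expectation_pmf_pos[OF finite_subst_blocks _ assms(1)])
  show "0 < real (window_count l ws (take l (drop k (concat ws))))"
    using assms(2) by (auto simp: window_count_def card_gt_0_iff)
qed simp

text \<open>Powers of the induced matrix see every window of an n-th image that starts inside the
  image of the first letter. This lets paths for letters be turned into paths for words of length
  \<open>l\<close>.\<close>

lemma mat_power_induced_matrix_pos:
  assumes v: "a # v \<in> language_len P l"
    and "x \<in> set_pmf (subst_iter P n [a])" "y \<in> set_pmf (subst_iter P n v)" "p < length x"
  shows "take l (drop p (x @ y)) \<in> language_len P l \<and>
    0 < mat_power (language_len P l) (induced_matrix P l) n (take l (drop p (x @ y))) (a # v)"
  using assms(2-)
proof (induction n arbitrary: x y p)
  case 0
  then show ?case using v by (auto simp: language_len_def)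
next
  case (Suc n)
  let ?A = "language_len P l"
  have l: "l = Suc (length v)" using v by (auto simp: language_len_def)
  from Suc.prems obtain x' y' where x': "x' \<in> set_pmf (subst_iter P n [a])" "x \<in> set_pmf (subst_word P x')"
    and y': "y' \<in> set_pmf (subst_iter P n v)" "y \<in> set_pmf (subst_word P y')" by auto
  from x'(2) y'(2) obtain xs ys where xs: "x = concat xs" "list_all2 (\<lambda>w a. w \<in> set_pmf (P a)) xs x'"
    and ys: "y = concat ys" "list_all2 (\<lambda>w a. w \<in> set_pmf (P a)) ys y'"
    by (auto simp: set_subst_word set_subst_blocks)
  obtain q r where q: "q < length xs" "r < length (xs ! q)" "p = length (concat (take q xs)) + r"
    using concat_position Suc.prems(3) xs(1) by metis
  \<comment> \<open>The position \<open>p\<close> lies at offset \<open>r\<close> in the image of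
    letter number \<open>q\<close> of the previous word. So the window at \<open>p\<close> is the
    window at \<open>r\<close> in the image of the window \<open>u\<close> at \<open>q\<close>, and
    \<open>ws\<close> are the blocks of that image.\<close>
  define u where "u = take l (drop q (x' @ y'))"
  define ws where "ws = take l (drop q (xs @ ys))"
  have len: "length xs = length x'" "length ys = length y'"
    using xs ys by (auto dest: list_all2_lengthD)
  have u: "u \<in> ?A" "0 < mat_power ?A (induced_matrix P l) n u (a # v)"
    using Suc.IH[OF x'(1) y'(1), of q] q(1) len by (auto simp: u_def)
  have ws: "ws \<in> set_pmf (subst_blocks P u)"
    unfolding set_subst_blocks u_def ws_def using xs ys
    by (intro list_all2_takeI list_all2_dropI list_all2_appendI)
  have hd: "hd ws = xs ! q"
    using q(1) l by (simp add: ws_def hd_conv_nth nth_append)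
  have "drop p (concat (xs @ ys)) = drop r (concat (drop q (xs @ ys)))"
    unfolding q(3)
    using q(1) by (subst append_take_drop_id[of q "xs @ ys", symmetric], subst concat_append) simp
  also have "drop q (xs @ ys) = ws @ drop l (drop q (xs @ ys))"
    by (simp add: ws_def del: drop_append drop_drop)
  finally have "drop p (x @ y) = drop r (concat ws @ concat (drop l (drop q (xs @ ys))))"
    using xs(1) ys(1) by (metis concat_append)
  \<comment> \<open>The window at \<open>r\<close> must not run past the image of \<open>u\<close>;
    the \<open>l - 1\<close> non-empty blocks after the first leave enough room.\<close>
  moreover have "r + l \<le> length (concat ws)"
  proof -
    have "length ws = l" using subst_blocks_length[OF ws] u(1) by (simp add: language_len_def)
    then obtain ws' where ws': "ws = xs ! q # ws'" "length ws' = length v"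
      using hd l by (cases ws) auto
    then show ?thesis using length_concat_ge[of ws'] subst_blocks_nonempty[OF ws] q(2) l by simp
  qed
  ultimately have eq: "take l (drop p (x @ y)) = take l (drop r (concat ws))" by simp
  have mem: "take l (drop p (x @ y)) \<in> ?A"
    unfolding eq using q(2) hd l by (intro language_len_window[OF u(1) _ ws]) auto
  have "0 < induced_matrix P l (take l (drop p (x @ y))) u"
    unfolding eq using induced_matrix_posI[OF ws] q(2) hd by simp
  moreover have nn: "0 \<le> mat_power ?A (induced_matrix P l) m i j" for m i j
    by (induction m arbitrary: i) (auto intro!: sum_nonneg mult_nonneg_nonneg simp: induced_matrix_def)
  ultimately have "0 < mat_power ?A (induced_matrix P l) (Suc n) (take l (drop p (x @ y))) (a # v)"
    unfolding mat_power.simps using u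
    by (intro sum_pos2[of _ u] finite_language_len mult_pos_pos mult_nonneg_nonneg nn)
       (auto simp: induced_matrix_def)
  then show ?case using mem by simp
qed

text \<open>A positive entry of the power contains a path of positive matrix entries, and each such
  entry is realised by an image of positive probability.\<close>

lemma mat_power_subst_matrix_pos:
  assumes "0 < mat_power UNIV (subst_matrix P) n a b"
  shows "\<exists>w\<in>set_pmf (subst_iter P n [b]). a \<in> set w"
  using assms
proof (induction n arbitrary: a)
  case (Suc n)
  have nn: "0 \<le> mat_power UNIV (subst_matrix P) m i j" for m i j
    by (induction m arbitrary: i) (auto intro!: sum_nonneg mult_nonneg_nonneg simp: subst_matrix_def)
  from Suc.prems have "(\<Sum>k\<in>UNIV. subst_matrix P a k * mat_power UNIV (subst_matrix P) n k b) \<noteq> 0"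
    by simp
  then obtain k where k: "subst_matrix P a k * mat_power UNIV (subst_matrix P) n k b \<noteq> 0"
    by (rule sum.not_neutral_contains_not_neutral)
  moreover have "0 \<le> subst_matrix P a k" by (simp add: subst_matrix_def)
  ultimately have "0 < mat_power UNIV (subst_matrix P) n k b" "0 < subst_matrix P a k"
    using nn[of n k b] by (auto simp: less_le)
  with Suc.IH obtain w where w: "w \<in> set_pmf (subst_iter P n [b])" "k \<in> set w" by blast
  obtain x where x: "x \<in> set_pmf (subst_word P [k])" "occ [a] x \<noteq> 0"
    using expectation_pmf_pos_imp_ex[OF \<open>0 < subst_matrix P a k\<close>[unfolded subst_matrix_def]] by auto
  then have "1 \<le> occ [a] x" by simp
  then have "sublist [a] x" unfolding occ_pos_iff .
  have "sublist [k] w" using w(2) by (auto simp: sublist_def dest: split_list)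
  with x(1) obtain y where "y \<in> set_pmf (subst_iter P 1 w)" "sublist x y"
    by (auto elim: subst_iter_sublist[of "[k]" w x 1])
  with w(1) \<open>sublist [a] x\<close> have "y \<in> set_pmf (subst_iter P (Suc n) [b])" "a \<in> set y"
    using set_mono_sublist[of "[a]" x] set_mono_sublist[of x y] by auto
  then show ?case by blast
qed (auto split: if_splits)

end

section \<open>Counting windows, and deleting the first or last block of an image\<close>

lemma sum_card_fibres:
  fixes h :: nat
  assumes "finite X"
  shows "(\<Sum>x\<in>X. card {k. k < h \<and> W k = x}) = card {k. k < h \<and> W k \<in> X}"
proof -
  have "{k. k < h \<and> W k \<in> X} = (\<Union>x\<in>X. {k. k < h \<and> W k = x})" by auto
  also have "card \<dots> = (\<Sum>x\<in>X. card {k. k < h \<and> W k = x})"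
    using assms by (intro card_UN_disjoint) auto
  finally show ?thesis by simp
qed

lemma card_less_Suc_of_bool:
  "card {k. k < Suc h \<and> Q k} = card {k. k < h \<and> Q k} + of_bool (Q h)"
proof -
  have "{k. k < Suc h \<and> Q k} = {k. k < h \<and> Q k} \<union> {k. k = h \<and> Q k}" by (auto simp: less_Suc_eq)
  then show ?thesis by (cases "Q h") (auto simp: card_insert_if Collect_conv_if)
qed

text \<open>Both sides count \<open>Q\<close> on the positions 0 to \<open>h\<close>. The two end
  terms become the prefix probabilities in the recursion for the first-letter marginal.\<close>

lemma card_shifted:
  "card {k. k < h \<and> Q (Suc k)} + of_bool (Q 0) = card {k. k < h \<and> Q k} + of_bool (Q h)"
  by (induction h) (auto simp: card_less_Suc_of_bool)

text \<open>Independence of the blocks: forgetting the last one leaves the law of the others, so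
  expectations for \<open>u\<close> and \<open>butlast u\<close> can be compared on one
  space.\<close>

lemma map_pmf_butlast_subst_blocks:
  "map_pmf butlast (subst_blocks P u) = subst_blocks P (butlast u)"
proof (induction u)
  case (Cons a u)
  show ?case
  proof (cases "u = []")
    case True
    then show ?thesis by (simp add: pmf.map_comp o_def case_prod_unfold pair_return_pmf2)
  next
    case False
    have ne: "ws \<noteq> []" if "ws \<in> set_pmf (subst_blocks P u)" for ws
      using False that by (cases u) auto
    have "map_pmf butlast (subst_blocks P (a # u)) =
        map_pmf (\<lambda>(w, ws). w # butlast ws) (pair_pmf (P a) (subst_blocks P u))"
      by (auto simp: pmf.map_comp intro!: map_pmf_cong dest: ne)
    also have "\<dots> = map_pmf (\<lambda>(w, ws). w # ws) (pair_pmf (P a) (map_pmf butlast (subst_blocks P u)))"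
      unfolding pair_map_pmf2 pmf.map_comp by (rule map_pmf_cong) auto
    also have "\<dots> = subst_blocks P (butlast (a # u))"
      using False by (simp add: Cons.IH)
    finally show ?thesis .
  qed
qed simp

lemma map_pmf_tl_subst_blocks: "map_pmf tl (subst_blocks P (a # u)) = subst_blocks P u"
  by (simp add: pmf.map_comp o_def case_prod_unfold map_snd_pair_pmf)

lemma (in random_substitution) induced_matrix_nonneg: "0 \<le> induced_matrix P l u v"
  by (simp add: induced_matrix_def)

lemma (in random_substitution) set_subst_word_singleton:
  "set_pmf (subst_word P [a]) = set_pmf (P a)"
  by (auto simp: set_subst_word image_iff)

lemma (in random_substitution) window_fits:
  assumes "ws \<in> set_pmf (subst_blocks P v)" "v \<noteq> []" "k < length (hd ws)"
  shows "k + length v \<le> length (concat ws)"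
proof -
  have "length ws = length v" using subst_blocks_length[OF assms(1)] .
  then obtain w ws' where "ws = w # ws'" "Suc (length ws') = length v"
    using assms(2) by (cases ws) auto
  then show ?thesis using length_concat_ge[of ws'] subst_blocks_nonempty[OF assms(1)] assms(3) by simp
qed

locale expanding_primitive_substitution = random_substitution P for P :: "'a::finite \<Rightarrow> 'a list pmf" +
  assumes primitive: "primitive_subst P" and expanding: "expanding_subst P"
begin

text \<open>Primitivity provides a single exponent. It persists for larger ones because every letter
  has some letter whose image can contain it.\<close>

lemma eventually_all_letters:
  "\<exists>N>0. \<forall>n\<ge>N. \<forall>a b. \<exists>w\<in>set_pmf (subst_iter P n [b]). a \<in> set w"
proof -
  obtain N where N: "N > 0" "\<And>a b. 0 < mat_power UNIV (subst_matrix P) N a b"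
    using primitive by (auto simp: primitive_subst_def primitive_matrix_def)
  note base = mat_power_subst_matrix_pos[OF N(2)]
  \<comment> \<open>As \<open>N > 0\<close>, a word reached in \<open>N\<close> steps and containing
    \<open>a\<close> has a last step; the letter whose block holds \<open>a\<close> is the wanted
    \<open>c\<close>.\<close>
  have pre: "\<exists>c. \<exists>x\<in>set_pmf (subst_iter P 1 [c]). a \<in> set x" for a
  proof -
    obtain m where m: "N = Suc m" using N(1) by (cases N) auto
    obtain w w' where "w' \<in> set_pmf (subst_iter P m [a])" "w \<in> set_pmf (subst_word P w')" "a \<in> set w"
      using base[of a a] unfolding m by auto
    then obtain ws where ws: "ws \<in> set_pmf (subst_blocks P w')" "a \<in> set (concat ws)"
      by (auto simp: set_subst_word)
    then obtain i where i: "i < length ws" "a \<in> set (ws ! i)"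
      by (metis UN_E set_concat in_set_conv_nth)
    have "ws ! i \<in> set_pmf (P (w' ! i))"
      using ws(1) i(1) unfolding set_subst_blocks by (rule list_all2_nthD)
    then show ?thesis using i(2) by (auto simp: set_subst_word_singleton)
  qed
  have "\<forall>a b. \<exists>w\<in>set_pmf (subst_iter P n [b]). a \<in> set w" if "n \<ge> N" for n
    using that
  proof (induction n rule: dec_induct)
    case base
    then show ?case using mat_power_subst_matrix_pos[OF N(2)] by blast
  next
    case (step n)
    show ?case
    proof (intro allI)
      fix a b
      obtain c x where x: "x \<in> set_pmf (subst_iter P 1 [c])" "a \<in> set x" using pre by blast
      obtain w where w: "w \<in> set_pmf (subst_iter P n [b])" "c \<in> set w" using step.IH by blast
      have "sublist [c] w" using w(2) by (auto simp: sublist_def dest: split_list)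
      then obtain y where "y \<in> set_pmf (subst_iter P 1 w)" "sublist x y"
        using x(1) by (rule subst_iter_sublist)
      then show "\<exists>w\<in>set_pmf (subst_iter P (Suc n) [b]). a \<in> set w"
        using subst_iter_add[OF w(1), of y 1] x(2) set_mono_sublist[of x y] by auto
    qed
  qed
  then show ?thesis using N(1) by blast
qed

text \<open>In each round the first letter is driven to a letter \<open>c\<close> that can expand
  and then expanded, while the rest of the word cannot shrink; the length grows by at least
  one.\<close>

lemma ex_long_image: "\<exists>n. \<exists>w\<in>set_pmf (subst_iter P n [a]). j \<le> length w"
proof (induction j)
  case 0
  then show ?case using subst_iter_ex by blast
next
  case (Suc j)
  then obtain n w where w: "w \<in> set_pmf (subst_iter P n [a])" "j \<le> length w" by blast
  obtain b w' where bw: "w = b # w'" using subst_iter_length[OF w(1)] by (cases w) auto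
  obtain c where c: "measure_pmf.prob (subst_word P [c]) {w. length w > 1} > 0"
    using expanding by (auto simp: expanding_subst_def)
  then have "set_pmf (subst_word P [c]) \<inter> {w. length w > 1} \<noteq> {}"
    by (auto simp: measure_pmf_zero_iff[symmetric])
  then obtain x where x: "x \<in> set_pmf (subst_iter P 1 [c])" "length x > 1" by auto
  obtain N where "\<exists>w\<in>set_pmf (subst_iter P N [b]). c \<in> set w"
    using eventually_all_letters by blast
  then obtain y where y: "y \<in> set_pmf (subst_iter P N [b])" "c \<in> set y" by blast
  have "sublist [c] y" using y(2) by (auto simp: sublist_def dest: split_list)
  then obtain z where z: "z \<in> set_pmf (subst_iter P 1 y)" "sublist x z"
    using x(1) by (rule subst_iter_sublist)
  have zb: "z \<in> set_pmf (subst_iter P (N + 1) [b])" using subst_iter_add[OF y(1) z(1)] .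
  obtain z' where z': "z' \<in> set_pmf (subst_iter P (N + 1) w')" using subst_iter_ex by blast
  have "z @ z' \<in> set_pmf (subst_iter P (n + (N + 1)) [a])"
    using subst_iter_add[OF w(1), of _ "N + 1"] subst_iter_appendI[OF zb z']
    unfolding bw append_Cons append_Nil by blast
  moreover have "Suc j \<le> length (z @ z')"
    using w(2) x(2) z(2) subst_iter_length[OF z'] bw by (auto dest: sublist_length_le)
  ultimately show ?case by blast
qed

lemma language_len_nonempty:
  assumes "0 < l" shows "language_len P l \<noteq> {}"
proof -
  obtain n w where w: "w \<in> set_pmf (subst_iter P n [undefined])" "l \<le> length w"
    using ex_long_image by blast
  then have "take l w \<in> language_len P l"
    using assms unfolding language_len_def in_language_iff mem_Collect_eq
    by (intro conjI exI[of _ w] exI[of _ n] exI[of _ undefined]) auto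
  then show ?thesis by blast
qed

text \<open>From the first letter of \<open>v\<close> one reaches a letter that generates a word
  containing \<open>u\<close>; the resulting window starts inside the image of that first letter, so
  \<open>mat_power_induced_matrix_pos\<close> applies.\<close>

lemma primitive_induced_matrix:
  assumes l: "0 < l"
  shows "primitive_matrix (language_len P l) (induced_matrix P l)"
proof -
  let ?A = "language_len P l"
  obtain N where N: "N > 0" "\<And>n a b. n \<ge> N \<Longrightarrow> \<exists>w\<in>set_pmf (subst_iter P n [b]). a \<in> set w"
    using eventually_all_letters by blast
  have "\<forall>u\<in>?A. \<exists>m a w. w \<in> set_pmf (subst_iter P m [a]) \<and> sublist u w"
    by (auto simp: language_len_def in_language_iff)
  then obtain m a w where mw: "\<And>u. u \<in> ?A \<Longrightarrow> w u \<in> set_pmf (subst_iter P (m u) [a u])"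
    "\<And>u. u \<in> ?A \<Longrightarrow> sublist u (w u)" by metis
  \<comment> \<open>One exponent for all pairs: after reserving \<open>m u\<close> steps to produce
    \<open>u\<close>, at least \<open>N\<close> steps remain to reach the letter
    \<open>a u\<close>.\<close>
  define n where "n = N + Max (m ` ?A)"
  have "0 < mat_power ?A (induced_matrix P l) n u v" if u: "u \<in> ?A" and v: "v \<in> ?A" for u v
  proof -
    obtain b v' where bv: "v = b # v'" using v l by (cases v) (auto simp: language_len_def)
    have mu: "m u \<le> Max (m ` ?A)" using u finite_language_len by (intro Max_ge) auto
    then have "N \<le> n - m u" by (simp add: n_def)
    then obtain x where x: "x \<in> set_pmf (subst_iter P (n - m u) [b])" "a u \<in> set x"
      using N(2) by blast
    have "sublist [a u] x" using x(2) by (auto simp: sublist_def dest: split_list)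
    then obtain y where y: "y \<in> set_pmf (subst_iter P (m u) x)" "sublist (w u) y"
      using mw(1)[OF u] by (rule subst_iter_sublist)
    have yn: "y \<in> set_pmf (subst_iter P n [b])"
      using subst_iter_add[OF x(1) y(1)] mu by (simp add: n_def)
    have "sublist u y" using sublist_order.order.trans[OF mw(2)[OF u] y(2)] .
    then obtain ps ss where ps: "y = ps @ u @ ss" by (auto simp: sublist_def)
    obtain z where z: "z \<in> set_pmf (subst_iter P n v')" using subst_iter_ex by blast
    have lu: "length u = l" using u by (simp add: language_len_def)
    then have "take l (drop (length ps) (y @ z)) = u" "length ps < length y" using ps l by auto
    with mat_power_induced_matrix_pos[OF v[unfolded bv] yn z, of "length ps"] show ?thesis
      by (simp add: bv)
  qed
  then show ?thesis using N(1)
    by (auto simp: primitive_matrix_def induced_matrix_nonneg n_def intro!: exI[of _ n])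
qed

lemma primitive_index_induced_matrix:
  "0 < l \<Longrightarrow> primitive_index_matrix (language_len P l) (induced_matrix P l)"
  by unfold_locales (auto simp: finite_language_len language_len_nonempty primitive_induced_matrix)

subsection \<open>Consistency of the Perron--Frobenius vectors\<close>

abbreviation "PF_root l \<equiv> PF_eigenvalue (language_len P l) (induced_matrix P l)"

lemma
  assumes "0 < l"
  shows induced_PF_vector_pos: "u \<in> language_len P l \<Longrightarrow> 0 < induced_PF_vector P l u"
    and induced_PF_vector_outside: "u \<notin> language_len P l \<Longrightarrow> induced_PF_vector P l u = 0"
    and sum_induced_PF_vector: "(\<Sum>u\<in>language_len P l. induced_PF_vector P l u) = 1"
    and induced_PF_vector_eigen: "u \<in> language_len P l \<Longrightarrow>
      (\<Sum>v\<in>language_len P l. induced_matrix P l u v * induced_PF_vector P l v) = PF_root l * induced_PF_vector P l u"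
proof -
  interpret primitive_index_matrix "language_len P l" "induced_matrix P l"
    using primitive_index_induced_matrix[OF assms] .
  show "u \<in> language_len P l \<Longrightarrow> 0 < induced_PF_vector P l u"
    "u \<notin> language_len P l \<Longrightarrow> induced_PF_vector P l u = 0"
    "(\<Sum>u\<in>language_len P l. induced_PF_vector P l u) = 1"
    "u \<in> language_len P l \<Longrightarrow>
      (\<Sum>v\<in>language_len P l. induced_matrix P l u v * induced_PF_vector P l v) = PF_root l * induced_PF_vector P l u"
    unfolding induced_PF_vector_def
    by (fact PF_right_eigenvector_pos PF_right_eigenvector_outside sum_PF_right_eigenvector
        PF_right_eigenvector_eigen)+
qed

lemma induced_PF_vector_nonneg: "0 < l \<Longrightarrow> 0 \<le> induced_PF_vector P l u"
  using induced_PF_vector_pos[of l u] induced_PF_vector_outside[of l u]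
  by (cases "u \<in> language_len P l") auto

lemma butlast_language_len: "0 < l \<Longrightarrow> x \<in> language_len P (Suc l) \<Longrightarrow> butlast x \<in> language_len P l"
  and tl_language_len: "0 < l \<Longrightarrow> x \<in> language_len P (Suc l) \<Longrightarrow> tl x \<in> language_len P l"
  by (auto simp: language_len_def intro!: language_sublist[of x] dest: arg_cong[where f=length])

text \<open>Shortened by its last letter, a window is the shorter window at the same position, and
  that one fits into the image of \<open>butlast y\<close>; the counts agree realisation by
  realisation. As \<open>l\<close> is positive, \<open>y\<close> and \<open>butlast y\<close> share
  their first letter.\<close>

lemma sum_induced_matrix_butlast:
  assumes l: "0 < l" and y: "y \<in> language_len P (Suc l)"
  shows "(\<Sum>x | x \<in> language_len P (Suc l) \<and> butlast x = u. induced_matrix P (Suc l) x y)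
    = induced_matrix P l u (butlast y)"
proof -
  let ?X = "{x \<in> language_len P (Suc l). butlast x = u}"
  have leny: "length y = Suc l" using y by (simp add: language_len_def)
  have "(\<Sum>x\<in>?X. real (window_count (Suc l) ws x)) = real (window_count l (butlast ws) u)"
    if ws: "ws \<in> set_pmf (subst_blocks P y)" for ws
  proof -
    have lenws: "length ws = Suc l" using subst_blocks_length[OF ws] leny by simp
    then have ne: "butlast ws \<noteq> []" "ws \<noteq> []" using l by (auto simp flip: length_greater_0_conv)
    have hd: "hd (butlast ws) = hd ws" using ne by (cases ws) auto
    have bl: "butlast ws \<in> set_pmf (subst_blocks P (butlast y))"
      using ws by (simp flip: map_pmf_butlast_subst_blocks)
    have c: "concat ws = concat (butlast ws) @ last ws"
      using ne by (metis append_butlast_last_id concat.simps concat_append append_Nil2)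
    have "take (Suc l) (drop k (concat ws)) \<in> ?X \<longleftrightarrow> take l (drop k (concat (butlast ws))) = u"
      if "k < length (hd ws)" for k
    proof -
      have "take (Suc l) (drop k (concat ws)) \<in> language_len P (Suc l)"
        using language_len_window[OF y _ ws that] by simp
      moreover have "k + Suc l \<le> length (concat ws)"
        using window_fits[OF ws _ that] leny by (cases y) auto
      moreover have "k + l \<le> length (concat (butlast ws))"
        using window_fits[OF bl _ that[folded hd]] leny l by (simp flip: length_greater_0_conv)
      ultimately have "butlast (take (Suc l) (drop k (concat ws))) = take l (drop k (concat ws))"
        "take l (drop k (concat ws)) = take l (drop k (concat (butlast ws)))"
        by (simp add: butlast_take, simp add: c)
      then show ?thesis using \<open>take (Suc l) (drop k (concat ws)) \<in> language_len P (Suc l)\<close> by simp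
    qed
    then show ?thesis
      by (simp add: window_count_def sum_card_fibres finite_language_len hd flip: of_nat_sum cong: conj_cong)
  qed
  then have "measure_pmf.expectation (subst_blocks P y) (\<lambda>ws. \<Sum>x\<in>?X. real (window_count (Suc l) ws x))
    = measure_pmf.expectation (subst_blocks P y) (\<lambda>ws. real (window_count l (butlast ws) u))"
    by (rule expectation_pmf_cong)
  then show ?thesis
    by (simp add: induced_matrix_eq Bochner_Integration.integral_sum integrable_measure_pmf_finite
        finite_subst_blocks flip: map_pmf_butlast_subst_blocks)
qed

text \<open>The matrix \<open>G\<close> of the overview.\<close>

definition prefix_prob :: "'a list \<Rightarrow> 'a list \<Rightarrow> real" where
  "prefix_prob u v = measure_pmf.expectation (subst_blocks P v) (\<lambda>ws. of_bool (take (length u) (concat ws) = u))"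

text \<open>Let h be the length of the first image. Dropping first letters replaces the starting
  positions 0, ..., h - 1 by 1, ..., h: the window at 0, a prefix of the image of
  \<open>butlast y\<close>, is lost, and the window at h, a prefix of the image of
  \<open>tl y\<close>, is gained.\<close>

lemma sum_induced_matrix_tl:
  assumes l: "0 < l" and y: "y \<in> language_len P (Suc l)" and u: "length u = l"
  shows "(\<Sum>x | x \<in> language_len P (Suc l) \<and> tl x = u. induced_matrix P (Suc l) x y)
    = induced_matrix P l u (butlast y) - prefix_prob u (butlast y) + prefix_prob u (tl y)"
proof -
  let ?X = "{x \<in> language_len P (Suc l). tl x = u}"
  have leny: "length y = Suc l" using y by (simp add: language_len_def)
  have pw: "(\<Sum>x\<in>?X. real (window_count (Suc l) ws x)) =
      real (window_count l (butlast ws) u) - of_bool (take l (concat (butlast ws)) = u)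
      + of_bool (take l (concat (tl ws)) = u)"
    if ws: "ws \<in> set_pmf (subst_blocks P y)" for ws
  proof -
    have lenws: "length ws = Suc l" using subst_blocks_length[OF ws] leny by simp
    then have ne: "butlast ws \<noteq> []" "ws \<noteq> []" using l by (auto simp flip: length_greater_0_conv)
    have hd: "hd (butlast ws) = hd ws" using ne by (cases ws) auto
    have bl: "butlast ws \<in> set_pmf (subst_blocks P (butlast y))"
      using ws by (simp flip: map_pmf_butlast_subst_blocks)
    have c: "concat ws = concat (butlast ws) @ last ws"
      using ne by (metis append_butlast_last_id concat.simps concat_append append_Nil2)
    have hpos: "0 < length (hd ws)" using subst_blocks_nonempty[OF ws] ne(2) by (cases ws) auto
    \<comment> \<open>Windows are read in the full image: those starting in the first block fit into
      the image of \<open>butlast y\<close>, but the one right after it may reach into the last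
      block.\<close>
    define Q where "Q k \<longleftrightarrow> take l (drop k (concat ws)) = u" for k
    have Q: "Q k \<longleftrightarrow> take l (drop k (concat (butlast ws))) = u" if "k < length (hd ws)" for k
    proof -
      have "k + l \<le> length (concat (butlast ws))"
        using window_fits[OF bl _ that[folded hd]] leny l by (simp flip: length_greater_0_conv)
      then show ?thesis by (simp add: Q_def c)
    qed
    have "take (Suc l) (drop k (concat ws)) \<in> ?X \<longleftrightarrow> Q (Suc k)" if "k < length (hd ws)" for k
      using language_len_window[OF y _ ws that]
      by (simp add: Q_def tl_take tl_drop drop_Suc)
    then have "(\<Sum>x\<in>?X. window_count (Suc l) ws x) = card {k. k < length (hd ws) \<and> Q (Suc k)}"
      by (simp add: window_count_def sum_card_fibres finite_language_len cong: conj_cong)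
    moreover have "card {k. k < length (hd ws) \<and> Q k} = window_count l (butlast ws) u"
      using Q by (simp add: window_count_def hd cong: conj_cong)
    moreover have "Q 0 \<longleftrightarrow> take l (concat (butlast ws)) = u" using Q[OF hpos] by simp
    moreover have "Q (length (hd ws)) \<longleftrightarrow> take l (concat (tl ws)) = u"
      using ne(2) by (cases ws) (auto simp: Q_def)
    ultimately have "(\<Sum>x\<in>?X. window_count (Suc l) ws x) + of_bool (take l (concat (butlast ws)) = u)
      = window_count l (butlast ws) u + of_bool (take l (concat (tl ws)) = u)"
      using card_shifted[of "length (hd ws)" Q] by simp
    then have "real ((\<Sum>x\<in>?X. window_count (Suc l) ws x) + of_bool (take l (concat (butlast ws)) = u))
      = real (window_count l (butlast ws) u + of_bool (take l (concat (tl ws)) = u))"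
      by (rule arg_cong)
    then show ?thesis by simp
  qed
  obtain b y' where by': "y = b # y'" using leny by (cases y) auto
  have tl: "subst_blocks P (tl y) = map_pmf tl (subst_blocks P y)"
    unfolding by' by (simp only: map_pmf_tl_subst_blocks list.sel)
  have "(\<Sum>x\<in>?X. induced_matrix P (Suc l) x y) =
    measure_pmf.expectation (subst_blocks P y) (\<lambda>ws. \<Sum>x\<in>?X. real (window_count (Suc l) ws x))"
    by (simp add: induced_matrix_eq Bochner_Integration.integral_sum integrable_measure_pmf_finite
        finite_subst_blocks)
  also have "\<dots> = measure_pmf.expectation (subst_blocks P y) (\<lambda>ws.
      real (window_count l (butlast ws) u) - of_bool (take l (concat (butlast ws)) = u)
      + of_bool (take l (concat (tl ws)) = u))"
    using pw by (rule expectation_pmf_cong)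
  also have "\<dots> = induced_matrix P l u (butlast y) - prefix_prob u (butlast y) + prefix_prob u (tl y)"
    by (simp add: induced_matrix_eq prefix_prob_def u tl integrable_measure_pmf_finite
        finite_subst_blocks flip: map_pmf_butlast_subst_blocks)
  finally show ?thesis .
qed

text \<open>Each position in the first image starts exactly one legal window.\<close>

lemma sum_induced_matrix_column:
  assumes l: "0 < l" and v: "v \<in> language_len P l"
  shows "(\<Sum>u\<in>language_len P l. induced_matrix P l u v)
    = measure_pmf.expectation (subst_blocks P v) (\<lambda>ws. real (length (hd ws)))"
proof -
  have "(\<Sum>u\<in>language_len P l. real (window_count l ws u)) = real (length (hd ws))"
    if ws: "ws \<in> set_pmf (subst_blocks P v)" for ws
    using language_len_window[OF v l ws]
    by (simp add: window_count_def sum_card_fibres finite_language_len flip: of_nat_sum cong: conj_cong)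
  then have "measure_pmf.expectation (subst_blocks P v) (\<lambda>ws. \<Sum>u\<in>language_len P l. real (window_count l ws u))
    = measure_pmf.expectation (subst_blocks P v) (\<lambda>ws. real (length (hd ws)))"
    by (rule expectation_pmf_cong)
  then show ?thesis
    by (simp add: induced_matrix_eq Bochner_Integration.integral_sum integrable_measure_pmf_finite
        finite_subst_blocks)
qed

text \<open>Summing the eigenvector equation over all letters exhibits the eigenvalue as an average,
  with positive weights, of expected image lengths. All of these are at least 1, and expansion makes
  one of them larger.\<close>

lemma eigenvalue_letters_gt_1: "1 < PF_root 1"
proof -
  let ?A = "language_len P 1" and ?R = "induced_PF_vector P 1"
  let ?E = "\<lambda>v. measure_pmf.expectation (subst_blocks P v) (\<lambda>ws. real (length (hd ws)))"
  let ?E1 = "\<lambda>v. measure_pmf.expectation (subst_blocks P v) (\<lambda>ws. real (length (hd ws)) - 1)"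
  have E1: "?E v - 1 = ?E1 v" for v
    by (simp add: integrable_measure_pmf_finite finite_subst_blocks)
  have hd1: "1 \<le> real (length (hd ws))" if "ws \<in> set_pmf (subst_blocks P v)" "v \<in> ?A" for ws v
  proof -
    have "length ws = 1" using subst_blocks_length[OF that(1)] that(2) by (simp add: language_len_def)
    then show ?thesis using subst_blocks_nonempty[OF that(1)]
      by (cases ws) (auto simp: Suc_le_eq simp flip: length_greater_0_conv)
  qed
  have nn: "0 \<le> ?E1 v" if "v \<in> ?A" for v
    using hd1[OF _ that] by (intro integral_nonneg_AE) (auto simp: AE_measure_pmf_iff)
  obtain c where c: "measure_pmf.prob (subst_word P [c]) {w. length w > 1} > 0"
    using expanding by (auto simp: expanding_subst_def)
  then have "set_pmf (subst_word P [c]) \<inter> {w. length w > 1} \<noteq> {}"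
    by (auto simp: measure_pmf_zero_iff[symmetric])
  then obtain x where x: "x \<in> set_pmf (P c)" "length x > 1" by (auto simp: set_subst_word_singleton)
  have cA: "[c] \<in> ?A" by (simp add: language_len_def language_letter)
  have "0 < ?E1 [c]"
    by (rule expectation_pmf_pos[OF finite_subst_blocks, of _ _ "[x]"])
       (use x hd1[OF _ cA] in \<open>auto simp: set_subst_blocks\<close>)
  then have "0 < (\<Sum>v\<in>?A. (?E v - 1) * ?R v)"
    using cA induced_PF_vector_pos[of 1 "[c]"] unfolding E1
    by (intro sum_pos2[of _ "[c]"] finite_language_len)
       (auto intro!: mult_nonneg_nonneg mult_pos_pos nn induced_PF_vector_nonneg simp: E1)
  also have "(\<Sum>v\<in>?A. (?E v - 1) * ?R v) = (\<Sum>v\<in>?A. (\<Sum>u\<in>?A. induced_matrix P 1 u v) * ?R v) - 1"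
    using sum_induced_PF_vector[of 1]
    by (simp add: sum_induced_matrix_column left_diff_distrib sum_subtractf)
  also have "(\<Sum>v\<in>?A. (\<Sum>u\<in>?A. induced_matrix P 1 u v) * ?R v)
      = (\<Sum>u\<in>?A. \<Sum>v\<in>?A. induced_matrix P 1 u v * ?R v)"
    unfolding sum_distrib_right by (rule sum.swap)
  also have "\<dots> = PF_root 1"
    using sum_induced_PF_vector[of 1] by (simp add: induced_PF_vector_eigen flip: sum_distrib_left)
  finally show ?thesis by simp
qed

section \<open>The two marginals of the vector for length \<open>Suc l\<close>\<close>

definition butlast_marginal :: "nat \<Rightarrow> 'a list \<Rightarrow> real" where
  "butlast_marginal l u = (\<Sum>x | x \<in> language_len P (Suc l) \<and> butlast x = u. induced_PF_vector P (Suc l) x)"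

definition tl_marginal :: "nat \<Rightarrow> 'a list \<Rightarrow> real" where
  "tl_marginal l u = (\<Sum>x | x \<in> language_len P (Suc l) \<and> tl x = u. induced_PF_vector P (Suc l) x)"

lemma sum_butlast_marginal:
  assumes "0 < l"
  shows "(\<Sum>v\<in>language_len P l. f v * butlast_marginal l v)
    = (\<Sum>x\<in>language_len P (Suc l). f (butlast x) * induced_PF_vector P (Suc l) x)"
proof -
  have "(\<Sum>v\<in>language_len P l. f v * butlast_marginal l v)
    = (\<Sum>v\<in>language_len P l. \<Sum>x | x \<in> language_len P (Suc l) \<and> butlast x = v.
        f (butlast x) * induced_PF_vector P (Suc l) x)"
    unfolding butlast_marginal_def sum_distrib_left by (intro sum.cong) auto
  also have "\<dots> = (\<Sum>x\<in>language_len P (Suc l). f (butlast x) * induced_PF_vector P (Suc l) x)"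
    using butlast_language_len[OF assms] by (intro sum.group finite_language_len) auto
  finally show ?thesis .
qed

lemma sum_tl_marginal:
  assumes "0 < l"
  shows "(\<Sum>v\<in>language_len P l. f v * tl_marginal l v)
    = (\<Sum>x\<in>language_len P (Suc l). f (tl x) * induced_PF_vector P (Suc l) x)"
proof -
  have "(\<Sum>v\<in>language_len P l. f v * tl_marginal l v)
    = (\<Sum>v\<in>language_len P l. \<Sum>x | x \<in> language_len P (Suc l) \<and> tl x = v.
        f (tl x) * induced_PF_vector P (Suc l) x)"
    unfolding tl_marginal_def sum_distrib_left by (intro sum.cong) auto
  also have "\<dots> = (\<Sum>x\<in>language_len P (Suc l). f (tl x) * induced_PF_vector P (Suc l) x)"
    using tl_language_len[OF assms] by (intro sum.group finite_language_len) auto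
  finally show ?thesis .
qed

text \<open>The eigenvector equation for length \<open>Suc l\<close>, summed over a fibre of
  \<open>h\<close>; it is used for both \<open>butlast\<close> and \<open>tl\<close>.\<close>

lemma sum_marginal_eigen:
  assumes "0 < l"
  shows "(\<Sum>x\<in>language_len P (Suc l).
      (\<Sum>z | z \<in> language_len P (Suc l) \<and> h z = u. induced_matrix P (Suc l) z x) * induced_PF_vector P (Suc l) x)
    = PF_root (Suc l) * (\<Sum>z | z \<in> language_len P (Suc l) \<and> h z = u. induced_PF_vector P (Suc l) z)"
  unfolding sum_distrib_right
  by (subst sum.swap) (auto simp: induced_PF_vector_eigen sum_distrib_left intro!: sum.cong)

lemma butlast_marginal_eigen:
  assumes l: "0 < l" and u: "u \<in> language_len P l"
  shows "(\<Sum>v\<in>language_len P l. induced_matrix P l u v * butlast_marginal l v)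
    = PF_root (Suc l) * butlast_marginal l u"
proof -
  have "(\<Sum>v\<in>language_len P l. induced_matrix P l u v * butlast_marginal l v)
    = (\<Sum>x\<in>language_len P (Suc l).
      (\<Sum>z | z \<in> language_len P (Suc l) \<and> butlast z = u. induced_matrix P (Suc l) z x)
        * induced_PF_vector P (Suc l) x)"
    unfolding sum_butlast_marginal[OF l]
    by (intro sum.cong refl) (simp add: sum_induced_matrix_butlast[OF l])
  also have "\<dots> = PF_root (Suc l) * butlast_marginal l u"
    unfolding butlast_marginal_def by (rule sum_marginal_eigen[OF l])
  finally show ?thesis .
qed

lemma butlast_marginal_nonneg: "0 \<le> butlast_marginal l u"
  unfolding butlast_marginal_def by (intro sum_nonneg induced_PF_vector_nonneg) auto

lemma sum_butlast_marginal_1: "0 < l \<Longrightarrow> (\<Sum>v\<in>language_len P l. butlast_marginal l v) = 1"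
  using sum_butlast_marginal[of l "\<lambda>_. 1"] sum_induced_PF_vector[of "Suc l"] by simp

text \<open>The marginal is a non-negative normalised eigenvector of the shorter matrix, so
  uniqueness identifies the vector and the eigenvalue at once.\<close>

lemma butlast_marginal_eq:
  assumes l: "0 < l"
  shows "butlast_marginal l u = induced_PF_vector P l u" and "PF_root (Suc l) = PF_root l"
proof -
  interpret primitive_index_matrix "language_len P l" "induced_matrix P l"
    using primitive_index_induced_matrix[OF l] .
  have zero: "butlast_marginal l u = 0" if "u \<notin> language_len P l" for u
    unfolding butlast_marginal_def using butlast_language_len[OF l] that by (intro sum.neutral) auto
  have "induced_PF_vector P l = butlast_marginal l"
    unfolding induced_PF_vector_def
    by (rule PF_right_eigenvector_eqI[OF butlast_marginal_nonneg zero sum_butlast_marginal_1[OF l]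
          butlast_marginal_eigen[OF l]])
  then show "butlast_marginal l u = induced_PF_vector P l u" by simp
  obtain k where "k \<in> language_len P l" "butlast_marginal l k \<noteq> 0"
    using sum_butlast_marginal_1[OF l] by (metis sum.neutral zero_neq_one)
  then have "PF_root l = PF_root (Suc l)"
    using butlast_marginal_eigen[OF l] butlast_marginal_nonneg by (intro PF_eigenvalue_eqI) auto
  then show "PF_root (Suc l) = PF_root l" by simp
qed

lemma PF_root_gt_1: "0 < l \<Longrightarrow> 1 < PF_root l"
proof (induction l)
  case (Suc l)
  then show ?case using eigenvalue_letters_gt_1 butlast_marginal_eq(2)[of l] by (cases "l = 0") auto
qed simp

text \<open>A word has at most one prefix of length \<open>l\<close>, so the events are
  disjoint.\<close>

lemma sum_prefix_prob_le_1: "(\<Sum>u\<in>language_len P l. prefix_prob u v) \<le> 1"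
proof -
  have "(\<Sum>u\<in>language_len P l. prefix_prob u v)
    = measure_pmf.expectation (subst_blocks P v)
        (\<lambda>ws. \<Sum>u\<in>language_len P l. of_bool (take (length u) (concat ws) = u))"
    by (simp add: prefix_prob_def Bochner_Integration.integral_sum integrable_measure_pmf_finite
        finite_subst_blocks)
  also have "\<dots> = measure_pmf.expectation (subst_blocks P v)
        (\<lambda>ws. of_bool (take l (concat ws) \<in> language_len P l))"
  proof (rule expectation_pmf_cong)
    fix ws
    have "(\<Sum>u\<in>language_len P l. of_bool (take (length u) (concat ws) = u))
      = (\<Sum>u\<in>language_len P l. if u = take l (concat ws) then 1 else (0::real))"
      by (intro sum.cong) (auto simp: language_len_def)
    then show "(\<Sum>u\<in>language_len P l. of_bool (take (length u) (concat ws) = u))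
      = (of_bool (take l (concat ws) \<in> language_len P l) :: real)"
      by (simp add: finite_language_len)
  qed
  also have "\<dots> \<le> measure_pmf.expectation (subst_blocks P v) (\<lambda>ws. 1)"
    by (intro integral_mono integrable_measure_pmf_finite finite_subst_blocks) auto
  finally show ?thesis by simp
qed

lemma prefix_prob_nonneg: "0 \<le> prefix_prob u v"
  by (simp add: prefix_prob_def)

text \<open>
  The difference \<open>D\<close> of the two marginals satisfies \<open>r D = G D\<close>, where \<open>G u v\<close> is the probability that
  \<open>u\<close> is a prefix of the image of \<open>v\<close>. Columns of \<open>G\<close> sum to at most \<open>1 < r\<close>, so \<open>D = 0\<close>.
\<close>

lemma tl_marginal_eq:
  assumes l: "0 < l" and u: "u \<in> language_len P l"
  shows "tl_marginal l u = butlast_marginal l u"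
proof -
  let ?A = "language_len P l" and ?r = "PF_root (Suc l)"
  define D where "D v = tl_marginal l v - butlast_marginal l v" for v
  have D: "?r * D u = (\<Sum>v\<in>?A. prefix_prob u v * D v)" if u: "u \<in> ?A" for u
  proof -
    have lu: "length u = l" using u by (simp add: language_len_def)
    have "?r * tl_marginal l u = (\<Sum>x\<in>language_len P (Suc l).
      (\<Sum>z | z \<in> language_len P (Suc l) \<and> tl z = u. induced_matrix P (Suc l) z x)
        * induced_PF_vector P (Suc l) x)"
      unfolding tl_marginal_def by (rule sum_marginal_eigen[OF l, symmetric])
    also have "\<dots> = (\<Sum>x\<in>language_len P (Suc l).
      (induced_matrix P l u (butlast x) - prefix_prob u (butlast x) + prefix_prob u (tl x))
        * induced_PF_vector P (Suc l) x)"
      by (intro sum.cong refl) (simp add: sum_induced_matrix_tl[OF l _ lu])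
    also have "\<dots> = (\<Sum>v\<in>?A. induced_matrix P l u v * butlast_marginal l v)
      - (\<Sum>v\<in>?A. prefix_prob u v * butlast_marginal l v) + (\<Sum>v\<in>?A. prefix_prob u v * tl_marginal l v)"
      unfolding sum_butlast_marginal[OF l] sum_tl_marginal[OF l]
      by (simp add: distrib_right left_diff_distrib sum.distrib sum_subtractf)
    \<comment> \<open>The first sum equals \<open>?r * butlast_marginal l u\<close>. Moving it to
      the left leaves the difference \<open>D\<close> on both sides.\<close>
    finally show ?thesis
      unfolding butlast_marginal_eigen[OF l u] D_def
      by (simp add: right_diff_distrib sum_subtractf)
  qed
  have "?r * (\<Sum>u\<in>?A. \<bar>D u\<bar>) = (\<Sum>u\<in>?A. \<bar>\<Sum>v\<in>?A. prefix_prob u v * D v\<bar>)"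
    unfolding sum_distrib_left using PF_root_gt_1[of "Suc l"]
    by (intro sum.cong refl) (simp add: abs_mult flip: D)
  also have "\<dots> \<le> (\<Sum>u\<in>?A. \<Sum>v\<in>?A. prefix_prob u v * \<bar>D v\<bar>)"
    by (intro sum_mono order.trans[OF sum_abs]) (simp add: abs_mult prefix_prob_nonneg)
  also have "\<dots> = (\<Sum>v\<in>?A. (\<Sum>u\<in>?A. prefix_prob u v) * \<bar>D v\<bar>)"
    unfolding sum_distrib_right by (rule sum.swap)
  also have "\<dots> \<le> (\<Sum>v\<in>?A. 1 * \<bar>D v\<bar>)"
    by (intro sum_mono mult_right_mono sum_prefix_prob_le_1) auto
  finally have "(?r - 1) * (\<Sum>u\<in>?A. \<bar>D u\<bar>) \<le> 0" by (simp add: left_diff_distrib)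
  then have "(\<Sum>u\<in>?A. \<bar>D u\<bar>) \<le> 0"
    using PF_root_gt_1[of "Suc l"] by (simp add: mult_le_0_iff)
  then have "(\<Sum>u\<in>?A. \<bar>D u\<bar>) = 0" by (intro antisym sum_nonneg) auto
  then have "D u = 0" using u by (simp add: sum_nonneg_eq_0_iff finite_language_len)
  then show ?thesis by (simp add: D_def)
qed

text \<open>The vector vanishes outside the language, so summing over all letters is the same as
  summing over legal extensions.\<close>

lemma sum_induced_PF_vector_snoc:
  assumes "0 < length u"
  shows "(\<Sum>a\<in>UNIV. induced_PF_vector P (Suc (length u)) (u @ [a])) = induced_PF_vector P (length u) u"
proof -
  have "(\<Sum>a\<in>UNIV. induced_PF_vector P (Suc (length u)) (u @ [a]))
    = (\<Sum>x\<in>(\<lambda>a. u @ [a]) ` UNIV. induced_PF_vector P (Suc (length u)) x)"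
    by (subst sum.reindex) (auto simp: inj_def)
  also have "\<dots> = butlast_marginal (length u) u"
    unfolding butlast_marginal_def
  proof (rule sum.mono_neutral_right)
    show "{x \<in> language_len P (Suc (length u)). butlast x = u} \<subseteq> range (\<lambda>a. u @ [a])"
      by (auto simp: language_len_def image_iff) (metis append_butlast_last_id list.size(3) nat.distinct(1))
  qed (use induced_PF_vector_outside[of "Suc (length u)"] in auto)
  finally show ?thesis using butlast_marginal_eq(1)[OF assms] by simp
qed

lemma sum_induced_PF_vector_Cons:
  assumes "0 < length u"
  shows "(\<Sum>a\<in>UNIV. induced_PF_vector P (Suc (length u)) (a # u)) = induced_PF_vector P (length u) u"
proof -
  have "(\<Sum>a\<in>UNIV. induced_PF_vector P (Suc (length u)) (a # u))
    = (\<Sum>x\<in>(\<lambda>a. a # u) ` UNIV. induced_PF_vector P (Suc (length u)) x)"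
    by (subst sum.reindex) (auto simp: inj_def)
  also have "\<dots> = tl_marginal (length u) u"
    unfolding tl_marginal_def
  proof (rule sum.mono_neutral_right)
    show "{x \<in> language_len P (Suc (length u)). tl x = u} \<subseteq> range (\<lambda>a. a # u)"
      by (auto simp: language_len_def image_iff) (metis list.collapse list.size(3) nat.distinct(1))
  qed (use induced_PF_vector_outside[of "Suc (length u)"] in auto)
  finally have *: "(\<Sum>a\<in>UNIV. induced_PF_vector P (Suc (length u)) (a # u)) = tl_marginal (length u) u" .
  \<comment> \<open>Equality of the marginals is available for legal \<open>u\<close> only. For
    other \<open>u\<close> both sides are zero, because \<open>tl\<close> of a legal word is
    legal.\<close>
  show ?thesis
  proof (cases "u \<in> language_len P (length u)")
    case True
    then show ?thesis using tl_marginal_eq[OF assms] butlast_marginal_eq(1)[OF assms] * by simp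
  next
    case False
    then have "tl_marginal (length u) u = 0"
      unfolding tl_marginal_def using tl_language_len[OF assms] by (intro sum.neutral) auto
    then show ?thesis using * induced_PF_vector_outside[OF assms False] by simp
  qed
qed

lemma sum_induced_PF_vector_letters: "(\<Sum>a\<in>UNIV. induced_PF_vector P 1 [a]) = 1"
proof -
  have "language_len P 1 = (\<lambda>a. [a]) ` UNIV"
    using language_letter by (auto simp: language_len_def length_Suc_conv image_iff)
  then have "(\<Sum>u\<in>language_len P 1. induced_PF_vector P 1 u) = (\<Sum>a\<in>UNIV. induced_PF_vector P 1 [a])"
    by (simp add: sum.reindex inj_def)
  then show ?thesis using sum_induced_PF_vector[of 1] by simp
qed

end

section \<open>Kolmogorov extension for consistent weights on words\<close>

lemma nth_window: "i < nat (m - k + 1) \<Longrightarrow> window x k m ! i = x (k + int i)"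
  by (simp add: window_def nth_upto)

lemma length_window [simp]: "length (window x k m) = nat (m - k + 1)"
  by (simp add: window_def)

lemma window_eq_iff: "window x k m = window y k m \<longleftrightarrow> (\<forall>i\<in>{k..m}. x i = y i)"
  by (auto simp: window_def)

lemma window_eq_list_iff:
  assumes "length v = nat (m - k + 1)"
  shows "window x k m = v \<longleftrightarrow> (\<forall>i\<in>{k..m}. x i = v ! nat (i - k))"
proof -
  have "v = window (\<lambda>i. v ! nat (i - k)) k m"
    using assms by (intro nth_equalityI) (auto simp: nth_window)
  then show ?thesis using window_eq_iff[of x k m "\<lambda>i. v ! nat (i - k)"] by simp
qed

text \<open>Weights of a shift-invariant measure on two-sided sequences: invariance is implicit in
  attaching weights to words irrespective of their position, which forces consistency on both
  ends.\<close>

locale consistent_word_weights =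
  fixes f :: "'a::finite list \<Rightarrow> real"
  assumes nonneg: "0 \<le> f u" and Nil: "f [] = 1"
    and sum_snoc: "(\<Sum>a\<in>UNIV. f (u @ [a])) = f u"
    and sum_Cons: "(\<Sum>a\<in>UNIV. f (a # u)) = f u"
begin

definition word_pmf :: "nat \<Rightarrow> 'a list pmf" where
  "word_pmf n = embed_pmf (\<lambda>u. if length u = n then f u else 0)"

lemma finite_words: "finite {u :: 'a list. length u = n}"
  using finite_lists_length_eq[of "UNIV :: 'a set" n] by simp

lemma sum_words: "(\<Sum>u | length u = n. f u) = 1"
proof (induction n)
  case (Suc n)
  have "(\<Sum>u | length u = Suc n. f u) = (\<Sum>u\<in>(\<lambda>(u, a). u @ [a]) ` ({u. length u = n} \<times> UNIV). f u)"
    by (intro sum.cong) (auto simp: length_Suc_conv_rev image_iff)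
  also have "\<dots> = (\<Sum>(u, a)\<in>{u. length u = n} \<times> UNIV. f (u @ [a]))"
    by (subst sum.reindex) (auto simp: inj_on_def case_prod_unfold)
  also have "\<dots> = (\<Sum>u | length u = n. f u)"
    by (simp add: sum_snoc flip: sum.cartesian_product)
  finally show ?case using Suc by simp
qed (simp add: Nil)

lemma pmf_word_pmf: "pmf (word_pmf n) u = (if length u = n then f u else 0)"
  unfolding word_pmf_def
proof (rule pmf_embed_pmf)
  have "(\<integral>\<^sup>+ u. ennreal (if length u = n then f u else 0) \<partial>count_space UNIV)
    = (\<Sum>u | length u = n. ennreal (if length u = n then f u else 0))"
    by (rule nn_integral_count_space'[OF finite_words]) auto
  also have "\<dots> = ennreal (\<Sum>u | length u = n. f u)"
    by (subst sum_ennreal[symmetric]) (auto simp: nonneg)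
  finally show "(\<integral>\<^sup>+ u. ennreal (if length u = n then f u else 0) \<partial>count_space UNIV) = 1"
    by (simp add: sum_words)
qed (simp add: nonneg)

lemma set_word_pmf: "u \<in> set_pmf (word_pmf n) \<Longrightarrow> length u = n"
  by (auto simp: set_pmf_iff pmf_word_pmf split: if_splits)

lemma map_butlast_word_pmf: "map_pmf butlast (word_pmf (Suc n)) = word_pmf n"
proof (rule pmf_eqI)
  fix u :: "'a list"
  have "pmf (map_pmf butlast (word_pmf (Suc n))) u
      = measure_pmf.prob (word_pmf (Suc n)) (if length u = n then (\<lambda>a. u @ [a]) ` UNIV else {})"
    unfolding pmf_map
  proof (rule measure_prob_cong_0)
    fix x assume x: "x \<in> butlast -` {u} - (if length u = n then range (\<lambda>a. u @ [a]) else {})"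
    have "length x \<noteq> Suc n"
    proof
      assume "length x = Suc n"
      then have "x = butlast x @ [last x]" "length (butlast x) = n" by (cases x rule: rev_cases; simp)+
      then show False using x by auto
    qed
    then show "pmf (word_pmf (Suc n)) x = 0" by (simp add: pmf_word_pmf)
  qed (auto split: if_splits)
  also have "\<dots> = pmf (word_pmf n) u"
    by (simp add: measure_measure_pmf_finite pmf_word_pmf sum.reindex inj_def sum_snoc)
  finally show "pmf (map_pmf butlast (word_pmf (Suc n))) u = pmf (word_pmf n) u" .
qed

lemma map_tl_word_pmf: "map_pmf tl (word_pmf (Suc n)) = word_pmf n"
proof (rule pmf_eqI)
  fix u :: "'a list"
  have "pmf (map_pmf tl (word_pmf (Suc n))) u
      = measure_pmf.prob (word_pmf (Suc n)) (if length u = n then (\<lambda>a. a # u) ` UNIV else {})"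
    unfolding pmf_map
  proof (rule measure_prob_cong_0)
    fix x assume x: "x \<in> tl -` {u} - (if length u = n then range (\<lambda>a. a # u) else {})"
    have "length x \<noteq> Suc n" using x by (cases x) auto
    then show "pmf (word_pmf (Suc n)) x = 0" by (simp add: pmf_word_pmf)
  qed (auto split: if_splits)
  also have "\<dots> = pmf (word_pmf n) u"
    by (simp add: measure_measure_pmf_finite pmf_word_pmf sum.reindex inj_def sum_Cons)
  finally show "pmf (map_pmf tl (word_pmf (Suc n))) u = pmf (word_pmf n) u" .
qed

lemma map_take_word_pmf: "map_pmf (take n) (word_pmf (n + k)) = word_pmf n"
proof (induction k)
  case 0
  have "map_pmf (take n) (word_pmf n) = map_pmf id (word_pmf n)"
    by (rule map_pmf_cong) (auto dest: set_word_pmf)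
  then show ?case by (simp add: pmf.map_id)
next
  case (Suc k)
  have "map_pmf (take n) (word_pmf (n + Suc k)) = map_pmf (take n) (map_pmf butlast (word_pmf (Suc (n + k))))"
    unfolding pmf.map_comp by (rule map_pmf_cong) (auto dest!: set_word_pmf simp: take_butlast)
  then show ?case using Suc by (simp add: map_butlast_word_pmf)
qed

lemma map_drop_word_pmf: "map_pmf (drop k) (word_pmf (k + n)) = word_pmf n"
proof (induction k)
  case (Suc k)
  have "map_pmf (drop (Suc k)) (word_pmf (Suc k + n)) = map_pmf (drop k) (map_pmf tl (word_pmf (Suc (k + n))))"
    unfolding pmf.map_comp by (rule map_pmf_cong) (auto simp: drop_Suc)
  then show ?case using Suc by (simp add: map_tl_word_pmf)
qed (simp add: pmf.map_id[unfolded id_def])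

text \<open>A random word is placed on the interval from \<open>k\<close> to \<open>m\<close> and
  read on \<open>J\<close>. The type \<open>discrete\<close> gives the alphabet the discrete
  topology, so that it is a Polish space as the extension theorem demands.\<close>

definition block_measure :: "int \<Rightarrow> int \<Rightarrow> int set \<Rightarrow> (int \<Rightarrow> 'a discrete) measure" where
  "block_measure k m J = distr (measure_pmf (word_pmf (nat (m - k + 1)))) (PiM J (\<lambda>_. borel))
     (\<lambda>w. \<lambda>i\<in>J. discrete (w ! nat (i - k)))"

lemma restrict_in_space [simp]: "(\<lambda>i\<in>J. g i) \<in> space (PiM J (\<lambda>_. borel))"
  by (simp add: space_PiM)

text \<open>Cutting the overhanging letters off a longer random word by \<open>take\<close> and
  \<open>drop\<close> gives the law of the shorter word; consistency on the right and on the left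
  each enter once.\<close>

lemma block_measure_widen:
  assumes "k' \<le> k" "k \<le> m" "m \<le> m'" "J \<subseteq> {k..m}"
  shows "block_measure k m J = block_measure k' m' J"
proof -
  define n where "n = nat (m - k + 1)"
  define p where "p = nat (k - k')"
  define q where "q = nat (m' - m)"
  have n': "nat (m' - k' + 1) = p + (n + q)" using assms by (simp add: n_def p_def q_def)
  let ?W = "word_pmf (p + (n + q))"
  have W: "word_pmf n = map_pmf (\<lambda>w. take n (drop p w)) ?W"
    using map_take_word_pmf[of n q] map_drop_word_pmf[of p "n + q"]
    by (metis map_pmf_comp)
  have "block_measure k m J =
      distr (measure_pmf ?W) (PiM J (\<lambda>_. borel)) (\<lambda>w. \<lambda>i\<in>J. discrete (take n (drop p w) ! nat (i - k)))"
    unfolding block_measure_def n_def[symmetric] W map_pmf_rep_eq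
    by (subst distr_distr) (auto simp: space_PiM o_def)
  also have "\<dots> = block_measure k' m' J"
    unfolding block_measure_def n'
  proof (rule distr_cong_AE)
    show "AE w in measure_pmf ?W. (\<lambda>i\<in>J. discrete (take n (drop p w) ! nat (i - k)))
        = (\<lambda>i\<in>J. discrete (w ! nat (i - k')))"
      unfolding AE_measure_pmf_iff
    proof (intro ballI restrict_ext)
      fix w i assume w: "w \<in> set_pmf ?W" and "i \<in> J"
      then have i: "i \<in> {k..m}" using assms by auto
      then have "take n (drop p w) ! nat (i - k) = w ! (p + nat (i - k))"
        using set_word_pmf[OF w] by (subst nth_take) (auto simp: n_def)
      also have "p + nat (i - k) = nat (i - k')" using i assms by (auto simp: p_def)
      finally show "discrete (take n (drop p w) ! nat (i - k)) = discrete (w ! nat (i - k'))" by simp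
    qed
  qed auto
  finally show ?thesis .
qed

text \<open>Inserting 0 keeps the maximum meaningful for empty \<open>J\<close> and the interval
  around \<open>J\<close> non-empty.\<close>

definition radius :: "int set \<Rightarrow> int" where
  "radius J = Max (insert 0 (abs ` J))"

lemma subset_radius: "finite J \<Longrightarrow> J \<subseteq> {- radius J..radius J}" and radius_nonneg: "finite J \<Longrightarrow> 0 \<le> radius J"
proof -
  have "\<bar>i\<bar> \<le> radius J" if "finite J" "i \<in> J" for i
    using that unfolding radius_def by (intro Max_ge) auto
  then show "finite J \<Longrightarrow> J \<subseteq> {- radius J..radius J}" by (force simp: abs_le_iff)
  show "finite J \<Longrightarrow> 0 \<le> radius J" unfolding radius_def by (intro Max_ge) auto
qed

definition marginal :: "int set \<Rightarrow> (int \<Rightarrow> 'a discrete) measure" where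
  "marginal J = block_measure (- radius J) (radius J) J"

lemma marginal_eq:
  assumes "k \<le> m" "J \<subseteq> {k..m}"
  shows "marginal J = block_measure k m J"
proof -
  have fin: "finite J" using assms(2) finite_subset by blast
  define k' where "k' = min k (- radius J)"
  define m' where "m' = max m (radius J)"
  have "block_measure k m J = block_measure k' m' J"
    using assms by (intro block_measure_widen) (auto simp: k'_def m'_def)
  moreover have "marginal J = block_measure k' m' J"
    unfolding marginal_def using subset_radius[OF fin] radius_nonneg[OF fin]
    by (intro block_measure_widen) (auto simp: k'_def m'_def)
  ultimately show ?thesis by simp
qed

text \<open>Both marginals are read off one random word, on the interval belonging to the larger set
  \<open>H\<close>; projecting is then plain restriction.\<close>

sublocale polish_projective "UNIV :: int set" marginal
proof (intro polish_projective.intro projective_family.intro)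
  fix J H :: "int set"
  show "prob_space (marginal J)"
    unfolding marginal_def block_measure_def by (rule measure_pmf.prob_space_distr) simp
  assume JH: "J \<subseteq> H" "finite H"
  have "marginal J = block_measure (- radius H) (radius H) J"
    using subset_radius[OF JH(2)] radius_nonneg[OF JH(2)] JH(1) by (intro marginal_eq) auto
  also have "\<dots> = distr (marginal H) (PiM J (\<lambda>_. borel)) (\<lambda>f. restrict f J)"
    unfolding marginal_def block_measure_def
    by (subst distr_distr[OF measurable_restrict_subset[OF JH(1)]])
       (use JH(1) in \<open>auto simp: o_def Int_absorb1 restrict_restrict\<close>)
  finally show "marginal J = distr (marginal H) (PiM J (\<lambda>_. borel)) (\<lambda>f. restrict f J)" .
qed

text \<open>Fixing a window is an event on finitely many coordinates, and the corresponding box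
  pulls back to the single word \<open>v\<close>.\<close>

lemma
  assumes "k \<le> m" "length v = nat (m - k + 1)"
  shows sets_lim_window: "{x. window (\<lambda>i. of_discrete (x i)) k m = v} \<in> sets lim"
    and emeasure_lim_window: "emeasure lim {x. window (\<lambda>i. of_discrete (x i)) k m = v} = f v"
proof -
  let ?J = "{k..m}"
  define X where "X = (PiE ?J (\<lambda>i. {discrete (v ! nat (i - k))}))"
  have X: "X \<in> sets (PiM ?J (\<lambda>_. borel))"
    unfolding X_def by (intro sets_PiM_I_finite) auto
  have "{x. window (\<lambda>i. of_discrete (x i)) k m = v}
      = {x. \<forall>i\<in>?J. x i = discrete (v ! nat (i - k))}"
    unfolding window_eq_list_iff[OF assms(2)] by (metis of_discrete_inverse discrete_inverse UNIV_I)
  also have "\<dots> = emb UNIV ?J X"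
    by (auto simp: prod_emb_def X_def PiE_iff)
  finally have eq: "{x. window (\<lambda>i. of_discrete (x i)) k m = v} = emb UNIV ?J X" .
  show "{x. window (\<lambda>i. of_discrete (x i)) k m = v} \<in> sets lim"
    unfolding eq using X by (auto intro: measurable_prod_emb)
  let ?W = "word_pmf (nat (m - k + 1))"
  have "emeasure lim (emb UNIV ?J X) = emeasure (marginal ?J) X"
    using X by (intro emeasure_lim_emb) auto
  also have "marginal ?J = block_measure k m ?J" using assms by (intro marginal_eq) auto
  also have "emeasure (block_measure k m ?J) X =
      emeasure (measure_pmf ?W) ((\<lambda>w. \<lambda>i\<in>?J. discrete (w ! nat (i - k))) -` X)"
    unfolding block_measure_def using X by (subst emeasure_distr) auto
  also have "\<dots> = emeasure (measure_pmf ?W) {v}"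
  proof (rule emeasure_eq_AE)
    show "AE w in measure_pmf ?W. w \<in> (\<lambda>w. \<lambda>i\<in>?J. discrete (w ! nat (i - k))) -` X \<longleftrightarrow> w \<in> {v}"
      unfolding AE_measure_pmf_iff
    proof
      fix w assume "w \<in> set_pmf ?W"
      then have lw: "length w = nat (m - k + 1)" by (rule set_word_pmf)
      have "w \<in> (\<lambda>w. \<lambda>i\<in>?J. discrete (w ! nat (i - k))) -` X
          \<longleftrightarrow> (\<forall>i\<in>?J. w ! nat (i - k) = v ! nat (i - k))"
        by (auto simp: X_def PiE_iff discrete_inject)
      also have "\<dots> \<longleftrightarrow> window (\<lambda>i. w ! nat (i - k)) k m = v"
        unfolding window_eq_list_iff[OF assms(2)] ..
      also have "window (\<lambda>i. w ! nat (i - k)) k m = w"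
        using lw by (intro nth_equalityI) (auto simp: nth_window)
      finally show "w \<in> (\<lambda>w. \<lambda>i\<in>?J. discrete (w ! nat (i - k))) -` X \<longleftrightarrow> w \<in> {v}"
        unfolding singleton_iff .
    qed
  qed auto
  also have "\<dots> = f v"
    using assms(2) by (simp add: emeasure_pmf_single pmf_word_pmf)
  finally show "emeasure lim {x. window (\<lambda>i. of_discrete (x i)) k m = v} = f v" unfolding eq .
qed

end

section \<open>Cylinders of the subshift\<close>

lemma cylinder_mono:
  assumes "k' \<le> k" "m \<le> m'"
  shows "cylinder P k' m' (window x k' m') \<subseteq> cylinder P k m (window x k m)"
  using assms by (auto simp: cylinder_def window_eq_iff)

lemma cylinder_eq_windowI: "x \<in> cylinder P k m v \<Longrightarrow> cylinder P k m v = cylinder P k m (window x k m)"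
  by (auto simp: cylinder_def)

lemma window_in_language_len:
  "x \<in> subshift P \<Longrightarrow> k \<le> m \<Longrightarrow> window x k m \<in> language_len P (nat (m - k + 1))"
  by (simp add: subshift_def language_len_def)

lemma cylinders0_subset: "cylinders0 P \<subseteq> Pow (subshift P)"
  by (auto simp: cylinders0_def cylinder_def)

lemma countable_cylinders0:
  fixes P :: "'a::finite \<Rightarrow> 'a list pmf"
  shows "countable (cylinders0 P)"
proof -
  have "cylinders0 P \<subseteq> (\<lambda>(k, m, v). cylinder P k m v) ` UNIV \<union> {subshift P, {}}"
    unfolding cylinders0_def by force
  then show ?thesis by (rule countable_subset) auto
qed

lemma cylinder_in_cylinders0:
  "x \<in> subshift P \<Longrightarrow> k \<le> 0 \<Longrightarrow> 0 \<le> m \<Longrightarrow> cylinder P k m (window x k m) \<in> cylinders0 P"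
  unfolding cylinders0_def using window_in_language_len[of x P k m] by auto

text \<open>The topology is generated by cylinders over arbitrary windows, while
  \<open>cylinders0\<close> admits only windows containing 0. Enlarging a window around a point
  shrinks the cylinder, so the latter still form a base.\<close>

lemma openin_cylinder_base:
  assumes "openin (topology_generated_by (cylinders P)) U" "x \<in> U"
  shows "\<exists>k m. k \<le> 0 \<and> 0 \<le> m \<and> x \<in> subshift P \<and> cylinder P k m (window x k m) \<subseteq> U"
  using assms unfolding openin_topology_generated_by_iff
proof (induction rule: generate_topology_on.induct)
  case (Int A B)
  obtain k m where A: "k \<le> 0" "0 \<le> m" "x \<in> subshift P" "cylinder P k m (window x k m) \<subseteq> A"
    using Int by blast
  obtain k' m' where B: "k' \<le> 0" "0 \<le> m'" "cylinder P k' m' (window x k' m') \<subseteq> B"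
    using Int by blast
  have "cylinder P (min k k') (max m m') (window x (min k k') (max m m')) \<subseteq> A \<inter> B"
    using A(4) B(3) cylinder_mono[of "min k k'" k m "max m m'" P x]
      cylinder_mono[of "min k k'" k' m' "max m m'" P x] by fastforce
  then show ?case using A B by (intro exI[of _ "min k k'"] exI[of _ "max m m'"]) auto
next
  case (UN K)
  then show ?case by (meson Union_iff Union_upper order.trans)
next
  case (Basis S)
  then obtain k m v where S: "S = cylinder P k m v" by (auto simp: cylinders_def)
  then have "S = cylinder P k m (window x k m)" using cylinder_eq_windowI Basis by blast
  then have "cylinder P (min k 0) (max m 0) (window x (min k 0) (max m 0)) \<subseteq> S"
    using cylinder_mono[of "min k 0" k m "max m 0" P x] by simp
  moreover have "x \<in> subshift P" using S Basis by (auto simp: cylinder_def)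
  ultimately show ?case by (intro exI[of _ "min k 0"] exI[of _ "max m 0"]) auto
qed simp

text \<open>There are only countably many cylinders, so every open set is a countable union of
  members of \<open>cylinders0\<close>.\<close>

lemma sets_borel_subshift:
  fixes P :: "'a::finite \<Rightarrow> 'a list pmf"
  shows "sets (borel_subshift P) = sigma_sets (subshift P) (cylinders0 P)"
proof -
  let ?O = "{U. openin (topology_generated_by (cylinders P)) U}"
  have "?O \<subseteq> Pow (subshift P)"
    using openin_cylinder_base by blast
  then have "sets (borel_subshift P) = sigma_sets (subshift P) ?O"
    unfolding borel_subshift_def by (rule sets_measure_of)
  also have "\<dots> = sigma_sets (subshift P) (cylinders0 P)"
  proof (rule sigma_sets_eqI)
    fix U assume "U \<in> ?O"
    then have U: "\<exists>k m. k \<le> 0 \<and> 0 \<le> m \<and> x \<in> subshift P \<and> cylinder P k m (window x k m) \<subseteq> U"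
      if "x \<in> U" for x using openin_cylinder_base that by blast
    have "U \<subseteq> \<Union>{C \<in> cylinders0 P. C \<subseteq> U}"
    proof
      fix x assume "x \<in> U"
      from U[OF this] obtain k m where km: "k \<le> 0" "0 \<le> m" "x \<in> subshift P"
        "cylinder P k m (window x k m) \<subseteq> U" by blast
      moreover have "x \<in> cylinder P k m (window x k m)" using km by (simp add: cylinder_def)
      ultimately show "x \<in> \<Union>{C \<in> cylinders0 P. C \<subseteq> U}"
        using cylinder_in_cylinders0 by blast
    qed
    then have "U = \<Union>{C \<in> cylinders0 P. C \<subseteq> U}" by blast
    also have "\<dots> \<in> sigma_sets (subshift P) (cylinders0 P)"
      by (intro sigma_sets_UNION countable_subset[OF _ countable_cylinders0[of P]]) auto
    finally show "U \<in> sigma_sets (subshift P) (cylinders0 P)" .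
  next
    fix C assume "C \<in> cylinders0 P"
    then consider "C \<in> cylinders P" | "C = subshift P" | "C = {}"
      unfolding cylinders0_def cylinders_def by (auto dest: order.trans)
    then show "C \<in> sigma_sets (subshift P) ?O"
      by cases (auto intro: sigma_sets_top sigma_sets.Empty sigma_sets.Basic topology_generated_by_Basis)
  qed
  finally show ?thesis .
qed

lemma space_borel_subshift: "space (borel_subshift P) = subshift P"
  unfolding borel_subshift_def using openin_cylinder_base by (intro space_measure_of) blast

lemma Int_cylinders0:
  assumes "A \<in> cylinders0 P" "B \<in> cylinders0 P"
  shows "A \<inter> B \<in> cylinders0 P"
proof (cases "A \<inter> B = {} \<or> A = subshift P \<or> B = subshift P")
  case True
  have "A \<subseteq> subshift P" "B \<subseteq> subshift P" using assms cylinders0_subset by auto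
  then have "A \<inter> B \<in> {{}, A, B}" using True by auto
  then show ?thesis using assms by (auto simp: cylinders0_def)
next
  case False
  then obtain x where x: "x \<in> A" "x \<in> B" by auto
  have cyl: "\<exists>k m. k \<le> 0 \<and> 0 \<le> m \<and> C = cylinder P k m (window x k m)"
    if C: "C \<in> cylinders0 P" "C \<noteq> subshift P" "x \<in> C" for C
  proof -
    obtain k m v where "k \<le> 0" "0 \<le> m" "C = cylinder P k m v"
      using C by (auto simp: cylinders0_def)
    then show ?thesis using cylinder_eq_windowI C(3) by blast
  qed
  obtain k m where A: "k \<le> 0" "0 \<le> m" "A = cylinder P k m (window x k m)"
    using cyl[OF assms(1)] False x(1) by blast
  obtain k' m' where B: "k' \<le> 0" "0 \<le> m'" "B = cylinder P k' m' (window x k' m')"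
    using cyl[OF assms(2)] False x(2) by blast
  \<comment> \<open>Both windows contain 0, so their union is an interval. This is the reason for
    requiring \<open>k \<le> 0 \<le> m\<close>: over windows with a gap an intersection need not be
    a single cylinder.\<close>
  have "A \<inter> B = cylinder P (min k k') (max m m') (window x (min k k') (max m m'))"
    unfolding A(3) B(3) using A(1,2) B(1,2)
    by (auto simp: cylinder_def window_eq_iff min_def max_def)
  moreover have "x \<in> subshift P" using assms(1) x(1) cylinders0_subset by blast
  ultimately show ?thesis using A(1,2) B(1,2) by (simp add: cylinder_in_cylinders0)
qed

lemma semialgebra_cylinders0:
  fixes P :: "'a::finite \<Rightarrow> 'a list pmf"
  shows "semialgebra (subshift P) (cylinders0 P)"
  unfolding semialgebra_def
proof (intro conjI ballI)
  show "cylinders0 P \<subseteq> Pow (subshift P)" by (rule cylinders0_subset)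
  show "subshift P \<in> cylinders0 P" by (simp add: cylinders0_def)
  fix A assume A: "A \<in> cylinders0 P"
  show "A \<inter> B \<in> cylinders0 P" if "B \<in> cylinders0 P" for B using A that by (rule Int_cylinders0)
  show "\<exists>C\<subseteq>cylinders0 P. finite C \<and> disjoint C \<and> subshift P - A = \<Union> C"
  proof -
    consider "A = subshift P" | "A = {}" |
      k m v where "k \<le> 0" "0 \<le> m" "v \<in> language_len P (nat (m - k + 1))" "A = cylinder P k m v"
      using A by (auto simp: cylinders0_def)
    then show ?thesis
    proof cases
      case 1
      then show ?thesis by (intro exI[of _ "{}"]) auto
    next
      case 2
      then show ?thesis by (intro exI[of _ "{subshift P}"]) (auto simp: cylinders0_def)
    next
      case 3
      let ?L = "language_len P (nat (m - k + 1))"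
      have "finite ?L"
        by (rule finite_subset[OF _ finite_lists_length_eq[of UNIV "nat (m - k + 1)"]])
           (auto simp: language_len_def)
      moreover have "subshift P - A = \<Union> (cylinder P k m ` (?L - {v}))"
        using 3 window_in_language_len[of _ P k m] by (auto simp: cylinder_def)
      moreover have "disjoint (cylinder P k m ` (?L - {v}))"
        by (auto simp: disjoint_def cylinder_def)
      moreover have "cylinder P k m ` (?L - {v}) \<subseteq> cylinders0 P"
        using 3 by (auto simp: cylinders0_def)
      ultimately show ?thesis by (intro exI[of _ "cylinder P k m ` (?L - {v})"]) auto
    qed
  qed
qed

section \<open>From the limit measure to a measure on the subshift\<close>

context expanding_primitive_substitution
begin

text \<open>No word of length 0 is legal, so the vector for length 0 carries no information; the
  value 1 is dictated by the total weight of the letters.\<close>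

definition word_weight :: "'a list \<Rightarrow> real" where
  "word_weight u = (if u = [] then 1 else induced_PF_vector P (length u) u)"

lemma word_weight_outside: "u \<noteq> [] \<Longrightarrow> u \<notin> language P \<Longrightarrow> word_weight u = 0"
  by (simp add: word_weight_def induced_PF_vector_outside language_len_def)

lemma consistent_word_weight: "consistent_word_weights word_weight"
proof
  fix u :: "'a list"
  show "0 \<le> word_weight u" by (simp add: word_weight_def induced_PF_vector_nonneg)
  show "(\<Sum>a\<in>UNIV. word_weight (u @ [a])) = word_weight u"
    using sum_induced_PF_vector_snoc[of u] sum_induced_PF_vector_letters
    by (cases "u = []") (auto simp: word_weight_def)
  show "(\<Sum>a\<in>UNIV. word_weight (a # u)) = word_weight u"
    using sum_induced_PF_vector_Cons[of u] sum_induced_PF_vector_letters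
    by (cases "u = []") (auto simp: word_weight_def)
qed (simp add: word_weight_def)

text \<open>The Kolmogorov limit lives on all two-sided sequences. Illegal windows have weight zero
  and there are countably many windows, so almost every sequence lies in the subshift, and the limit
  can be pushed forward to it.\<close>

lemma ex_subshift_measure:
  "\<exists>N. prob_space N \<and> space N = subshift P \<and> sets N = sets (borel_subshift P) \<and>
    (\<forall>k m. k \<le> m \<longrightarrow> (\<forall>v\<in>language_len P (nat (m - k + 1)).
      emeasure N (cylinder P k m v) = ennreal (induced_PF_vector P (length v) v)))"
proof -
  interpret W: consistent_word_weights word_weight by (rule consistent_word_weight)
  let ?M = "W.lim"
  define \<phi> :: "(int \<Rightarrow> 'a discrete) \<Rightarrow> int \<Rightarrow> 'a" where "\<phi> x = (\<lambda>i. of_discrete (x i))" for x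
  have E: "{x. window (\<phi> x) k m = v} \<in> sets ?M"
    "emeasure ?M {x. window (\<phi> x) k m = v} = (if length v = nat (m - k + 1) then word_weight v else 0)"
    if "k \<le> m" for k m v
  proof -
    have "{x. window (\<phi> x) k m = v} = {}" if "length v \<noteq> nat (m - k + 1)"
      using that by auto
    then show "{x. window (\<phi> x) k m = v} \<in> sets ?M"
      "emeasure ?M {x. window (\<phi> x) k m = v} = (if length v = nat (m - k + 1) then word_weight v else 0)"
      using W.sets_lim_window[OF that, of v, folded \<phi>_def] W.emeasure_lim_window[OF that, of v, folded \<phi>_def]
      by (cases "length v = nat (m - k + 1)"; simp del: W.sets_lim)+
  qed
  have space: "space (PiM UNIV (\<lambda>_ :: int. borel :: 'a discrete measure)) = UNIV"
    by (simp add: space_PiM)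
  have lang: "{x. window (\<phi> x) k m \<notin> language P} \<in> null_sets ?M" if "k \<le> m" for k m
  proof -
    have "{x. window (\<phi> x) k m \<notin> language P}
        = (\<Union>v\<in>{v. length v = nat (m - k + 1) \<and> v \<notin> language P}. {x. window (\<phi> x) k m = v})"
      by auto
    also have "\<dots> \<in> null_sets ?M"
    proof (rule null_sets_UN')
      fix v assume v: "v \<in> {v. length v = nat (m - k + 1) \<and> v \<notin> language P}"
      then have "v \<noteq> []" using that by auto
      then show "{x. window (\<phi> x) k m = v} \<in> null_sets ?M"
        using v E[OF that, of v] by (auto intro!: null_setsI simp: word_weight_outside)
    qed auto
    finally show ?thesis .
  qed
  have null: "{x. \<phi> x \<notin> subshift P} \<in> null_sets ?M"
  proof -
    have "{x. \<phi> x \<notin> subshift P}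
        = (\<Union>(k, m)\<in>{(k, m). k \<le> m}. {x. window (\<phi> x) k m \<notin> language P})"
      by (auto simp: subshift_def)
    also have "\<dots> \<in> null_sets ?M"
      using lang by (intro null_sets_UN') auto
    finally show ?thesis .
  qed
  have AE: "AE x in ?M. \<phi> x \<in> subshift P"
    using AE_not_in[OF null] by simp
  \<comment> \<open>The subshift is non-empty because an empty set cannot contain almost every point
    of a probability space.\<close>
  have "\<exists>x. \<phi> x \<in> subshift P"
  proof (rule ccontr)
    assume "\<not> ?thesis"
    then have "AE x in ?M. False" using AE by simp
    then show False by (simp add: W.P.AE_False)
  qed
  then obtain z where z: "z \<in> subshift P" by blast
  \<comment> \<open>The exceptional null set is sent to the fixed point \<open>z\<close>, so that
    the map takes values in the subshift everywhere without changing any probability.\<close>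
  define g where "g x = (if \<phi> x \<in> subshift P then \<phi> x else z)" for x
  have cyl: "g -` cylinder P k m v \<inter> space ?M \<in> sets ?M" if "k \<le> m" for k m v
  proof -
    have "g -` cylinder P k m v \<inter> space ?M = (- {x. \<phi> x \<notin> subshift P} \<inter> {x. window (\<phi> x) k m = v})
        \<union> (if z \<in> cylinder P k m v then {x. \<phi> x \<notin> subshift P} else {})"
      using z by (auto simp: g_def cylinder_def space)
    also have "\<dots> \<in> sets ?M"
      using null_setsD2[OF null] E(1)[OF that] sets.compl_sets[OF null_setsD2[OF null]]
      by (auto simp: space Compl_eq_Diff_UNIV)
    finally show ?thesis .
  qed
  have g: "g \<in> measurable ?M (borel_subshift P)"
  proof (rule measurable_sigma_sets[OF sets_borel_subshift cylinders0_subset])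
    show "g \<in> space ?M \<rightarrow> subshift P" using z by (auto simp: g_def)
    fix C assume "C \<in> cylinders0 P"
    then consider "C = subshift P" | "C = {}" | k m v where "k \<le> 0" "0 \<le> m" "C = cylinder P k m v"
      by (auto simp: cylinders0_def)
    then show "g -` C \<inter> space ?M \<in> sets ?M"
    proof cases
      case 1
      then have "g -` C \<inter> space ?M = space ?M" using z by (auto simp: g_def)
      then show ?thesis by simp
    qed (use cyl in auto)
  qed
  show ?thesis
  proof (intro exI[of _ "distr ?M (borel_subshift P) g"] conjI allI impI ballI)
    show "prob_space (distr ?M (borel_subshift P) g)" by (rule W.P.prob_space_distr[OF g])
    show "space (distr ?M (borel_subshift P) g) = subshift P" by (simp add: space_borel_subshift)
    fix k m :: int and v :: "'a list" assume km: "k \<le> m" and v: "v \<in> language_len P (nat (m - k + 1))"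
    have "cylinder P k m v \<in> sets (borel_subshift P)"
    proof -
      have "openin (topology_generated_by (cylinders P)) (cylinder P k m v)"
        using km v by (intro topology_generated_by_Basis) (auto simp: cylinders_def)
      then show ?thesis unfolding borel_subshift_def
        using openin_cylinder_base by (subst sets_measure_of) (blast intro: sigma_sets.Basic)+
    qed
    then have "emeasure (distr ?M (borel_subshift P) g) (cylinder P k m v)
      = emeasure ?M (g -` cylinder P k m v \<inter> space ?M)"
      by (rule emeasure_distr[OF g])
    also have "\<dots> = emeasure ?M {x. window (\<phi> x) k m = v}"
      using AE by (intro emeasure_eq_AE E(1) cyl km) (auto simp: g_def cylinder_def space elim!: eventually_mono)
    also have "\<dots> = ennreal (induced_PF_vector P (length v) v)"
      using v km by (auto simp: E(2)[OF km] language_len_def word_weight_def)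
    finally show "emeasure (distr ?M (borel_subshift P) g) (cylinder P k m v)
      = ennreal (induced_PF_vector P (length v) v)" .
  qed simp
qed

end

theorem proposition5p3:
  fixes P :: "'a::finite \<Rightarrow> 'a list pmf"
  assumes "random_substitution P"
    and "primitive_subst P"
    and "expanding_subst P"
  shows "(\<exists>\<mu>. is_cylinder_function P \<mu>) \<and>
    (\<forall>\<mu>. is_cylinder_function P \<mu> \<longrightarrow>
      (\<forall>A\<in>cylinders0 P. \<mu> A \<le> 1) \<and>
      semialgebra_measure (subshift P) (cylinders0 P) \<mu> \<and>
      sigma_finite_on (subshift P) (cylinders0 P) \<mu> \<and>
      (\<exists>!N. space N = subshift P \<and> sets N = sets (borel_subshift P) \<and>
        (\<forall>A\<in>cylinders0 P. emeasure N A = \<mu> A)))"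
proof -
  interpret expanding_primitive_substitution P
    using assms by (simp add: expanding_primitive_substitution_def expanding_primitive_substitution_axioms_def)
  obtain N where N: "prob_space N" "space N = subshift P" "sets N = sets (borel_subshift P)"
    "\<And>k m v. k \<le> m \<Longrightarrow> v \<in> language_len P (nat (m - k + 1)) \<Longrightarrow>
      emeasure N (cylinder P k m v) = ennreal (induced_PF_vector P (length v) v)"
    using ex_subshift_measure by blast
  interpret N: prob_space N by fact
  have N1: "emeasure N (subshift P) = 1" using N.emeasure_space_1 N(2) by simp
  have "is_cylinder_function P (emeasure N)"
    unfolding is_cylinder_function_def using N1 N(4) by auto
  moreover have "(\<forall>A\<in>cylinders0 P. \<mu> A \<le> 1) \<and>
      semialgebra_measure (subshift P) (cylinders0 P) \<mu> \<and>
      sigma_finite_on (subshift P) (cylinders0 P) \<mu> \<and>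
      (\<exists>!N. space N = subshift P \<and> sets N = sets (borel_subshift P) \<and>
        (\<forall>A\<in>cylinders0 P. emeasure N A = \<mu> A))" if \<mu>: "is_cylinder_function P \<mu>" for \<mu>
  proof (intro conjI)
    \<comment> \<open>The defining equations determine every admissible \<open>\<mu>\<close> on
      \<open>cylinders0 P\<close>, so it inherits all properties of \<open>N\<close> there.\<close>
    have eq: "emeasure N A = \<mu> A" if "A \<in> cylinders0 P" for A
      using that \<mu> N1 N(4) unfolding cylinders0_def is_cylinder_function_def by fastforce
    have sets: "cylinders0 P \<subseteq> sets N"
      by (auto simp: N(3) sets_borel_subshift)
    have subshift: "subshift P \<in> cylinders0 P" by (simp add: cylinders0_def)
    show "\<forall>A\<in>cylinders0 P. \<mu> A \<le> 1"
      using N.measure_le_1 by (simp flip: eq)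
    have "countably_additive (cylinders0 P) \<mu>"
      unfolding countably_additive_def
    proof (intro allI impI)
      fix A :: "nat \<Rightarrow> _"
      assume A: "range A \<subseteq> cylinders0 P" "disjoint_family A" "\<Union> (range A) \<in> cylinders0 P"
      then have "\<mu> (A i) = emeasure N (A i)" for i by (intro eq[symmetric]) auto
      then have "(\<Sum>i. \<mu> (A i)) = (\<Sum>i. emeasure N (A i))" by simp
      also have "\<dots> = emeasure N (\<Union> (range A))" using A sets by (intro suminf_emeasure) auto
      finally show "(\<Sum>i. \<mu> (A i)) = \<mu> (\<Union> (range A))" using eq A by simp
    qed
    then show "semialgebra_measure (subshift P) (cylinders0 P) \<mu>"
      using \<mu> semialgebra_cylinders0
      by (auto simp: semialgebra_measure_def positive_def is_cylinder_function_def)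
    show "sigma_finite_on (subshift P) (cylinders0 P) \<mu>"
      unfolding sigma_finite_on_def using subshift \<mu>
      by (intro exI[of _ "\<lambda>_. subshift P"]) (auto simp: is_cylinder_function_def)
    show "\<exists>!N. space N = subshift P \<and> sets N = sets (borel_subshift P) \<and>
        (\<forall>A\<in>cylinders0 P. emeasure N A = \<mu> A)"
    proof (rule ex1I[of _ N])
      show "space N = subshift P \<and> sets N = sets (borel_subshift P) \<and>
        (\<forall>A\<in>cylinders0 P. emeasure N A = \<mu> A)" using N eq by simp
      fix N' assume N': "space N' = subshift P \<and> sets N' = sets (borel_subshift P) \<and>
        (\<forall>A\<in>cylinders0 P. emeasure N' A = \<mu> A)"
      \<comment> \<open>The cylinders with the empty set and the whole space form an
        intersection-stable generator, and the whole space has finite measure.\<close>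
      show "N' = N"
        by (rule measure_eqI_generator_eq[OF _ cylinders0_subset, where A = "\<lambda>_. subshift P"])
           (use N' N(3) eq subshift \<mu> in
             \<open>auto simp: Int_stable_def Int_cylinders0 sets_borel_subshift is_cylinder_function_def\<close>)
    qed
  qed
  ultimately show ?thesis by blast
qed

end
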